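(* Let $T\in L(\omega)$ be such that the dual operator $T'$ has no non-trivial finite dimensional invariant subspaces, and let $\{p_l\}_{l\in\mathbb Z_+}$ be a sequence of polynomials (with coefficients in $\mathbb K$) such that $\deg p_l\to\infty$ as $l\to\infty$. Then the sequence $\{p_l(T):l\in\mathbb Z_+\}$ is universal, that is, there is $x\in\omega$ such that $\{p_l(T)x:l\in\mathbb Z_+\}$ is dense in $\omega$. Moreover, there is no strongly continuous supercyclic operator semigroup $\{T_t\}_{t\in\mathbb R_+}$ on $\omega$.
   Context: $\mathbb K$ is $\mathbb R$ or $\mathbb C$; $\mathbb Z_+=\{0,1,2,\dots\}$; $\mathbb R_+=[0,\infty)$. $\omega=\mathbb K^{\mathbb N}$ is the space of all scalar sequences with the topology of coordinatewise convergence. $L(X)$ is the space of continuous linear operators on $X$, $X'$ is the space of continuous linear functionals on $X$, and $T':X'\to X'$ is given by $(T'f)(x)=f(Tx)$. A subspace is non-trivial if it is non-zero. An operator semigroup $\{T_t\}_{t\in\mathbb R_+}$ on a topological vector space $X$ is a family in $L(X)$ with $T_0=I$ and $T_{s+t}=T_tT_s$ for all $s,t\geq 0$. It is strongly continuous if $t\mapsto T_tx$ is continuous from $\mathbb R_+$ to $X$ for each $x\in X$. It is supercyclic if there is $x\in X$ such that $\{zT_tx:z\in\mathbb K,\ t\in\mathbb R_+\}$ is dense in $X$. *)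

theory Defs
  imports "HOL-Analysis.Analysis" "HOL-Library.Function_Algebras"
    "HOL-Computational_Algebra.Polynomial"
begin

text \<open>
  The scalar field is written \<open>'k\<close>; it is meant to be instantiated with \<^typ>\<open>real\<close> and
  \<^typ>\<open>complex\<close>. On function types, addition and zero are pointwise (Function_Algebras) and the
  topology is the product topology, i.e. that of coordinatewise convergence.
\<close>

type_synonym 'k omega = "nat \<Rightarrow> 'k"

text \<open>Pointwise scalar multiplication; used both on \<open>omega\<close> (index type \<^typ>\<open>nat\<close>) and on
  functionals on \<open>omega\<close> (index type \<open>'k omega\<close>).\<close>

definition fscale :: "'k::field \<Rightarrow> ('i \<Rightarrow> 'k) \<Rightarrow> ('i \<Rightarrow> 'k)" where
  "fscale c x = (\<lambda>i. c * x i)"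

global_interpretation fun_space: vector_space "fscale :: 'k::field \<Rightarrow> ('i \<Rightarrow> 'k) \<Rightarrow> ('i \<Rightarrow> 'k)"
  by unfold_locales (auto simp: fscale_def fun_eq_iff algebra_simps)

definition operators :: "('k::real_normed_field omega \<Rightarrow> 'k omega) set" where
  "operators = {T. Vector_Spaces.linear fscale fscale T \<and> continuous_on UNIV T}"

definition dual :: "('k::real_normed_field omega \<Rightarrow> 'k) set" where
  "dual = {f. Vector_Spaces.linear fscale (*) f \<and> continuous_on UNIV f}"

definition dual_op ::
  "('k omega \<Rightarrow> 'k omega) \<Rightarrow> ('k omega \<Rightarrow> 'k) \<Rightarrow> ('k omega \<Rightarrow> 'k)" where
  "dual_op T f = (\<lambda>x. f (T x))"

definition finite_dim :: "('i \<Rightarrow> 'k::field) set \<Rightarrow> bool" where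
  "finite_dim M \<longleftrightarrow> (\<exists>B. finite B \<and> M = fun_space.span B)"

definition dual_invariant_subspace ::
  "('k::real_normed_field omega \<Rightarrow> 'k omega) \<Rightarrow> ('k omega \<Rightarrow> 'k) set \<Rightarrow> bool" where
  "dual_invariant_subspace T M \<longleftrightarrow>
     M \<subseteq> dual \<and> fun_space.subspace M \<and> dual_op T ` M \<subseteq> M"

definition poly_op ::
  "'k::real_normed_field poly \<Rightarrow> ('k omega \<Rightarrow> 'k omega) \<Rightarrow> ('k omega \<Rightarrow> 'k omega)" where
  "poly_op p T = (\<lambda>x. \<Sum>i\<le>degree p. fscale (coeff p i) ((T ^^ i) x))"

definition universal :: "(nat \<Rightarrow> 'k::real_normed_field omega \<Rightarrow> 'k omega) \<Rightarrow> bool" where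
  "universal F \<longleftrightarrow> (\<exists>x. closure {F l x |l. True} = UNIV)"

text \<open>Semigroups are indexed by \<^typ>\<open>real\<close>; only the values at nonnegative times matter.\<close>

definition operator_semigroup :: "(real \<Rightarrow> 'k::real_normed_field omega \<Rightarrow> 'k omega) \<Rightarrow> bool" where
  "operator_semigroup S \<longleftrightarrow>
     (\<forall>t\<ge>0. S t \<in> operators) \<and> S 0 = id \<and> (\<forall>s\<ge>0. \<forall>t\<ge>0. S (s + t) = S t \<circ> S s)"

definition strongly_continuous :: "(real \<Rightarrow> 'k::real_normed_field omega \<Rightarrow> 'k omega) \<Rightarrow> bool" where
  "strongly_continuous S \<longleftrightarrow> (\<forall>x. continuous_on {0..} (\<lambda>t. S t x))"

definition supercyclic :: "(real \<Rightarrow> 'k::real_normed_field omega \<Rightarrow> 'k omega) \<Rightarrow> bool" where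
  "supercyclic S \<longleftrightarrow> (\<exists>x. closure {fscale z (S t x) |z t. 0 \<le> t} = UNIV)"

end

theory Submission
  imports Defs "HOL-Computational_Algebra.Fundamental_Theorem_Algebra"
begin

text \<open>
  Universality: the dual \<open>X'\<close> is a torsion-free \<open>K[t]\<close>-module via \<open>T'\<close>, since a torsion element
  generates a finite-dimensional invariant subspace. For a finite-dimensional \<open>E \<subseteq> X'\<close> the spaces \<open>E\<close> and
  \<open>p(T')E\<close> then meet trivially once \<open>deg p\<close> is large, so finitely many coordinates of both \<open>x\<close> and
  \<open>p(T)x\<close> can be prescribed, and Baire's theorem gives a universal vector.

  Semigroups: by uniform boundedness every coordinate functional lies in a finite-dimensional
  space of functionals invariant under all \<open>S\<^sub>t'\<close>. After complexification, triangularising the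
  commuting \<open>S\<^sub>t'\<close> on this space yields functionals \<open>f, g\<close> with \<open>g \<circ> S\<^sub>t = a\<^sub>t g\<close> and
  \<open>f \<circ> S\<^sub>t = b\<^sub>t f + c\<^sub>t g\<close>. Along an orbit the quotient \<open>f/g\<close> is invariant under scalar multiples and
  moves by an affine flow in the complex plane; density of the orbit would put a whole real line
  into the closure of that curve, which is impossible.
\<close>

section \<open>Polynomials in an endomorphism\<close>

text \<open>Two obstacles shape the second half. First, \<open>real\<close> scalars need not provide
  eigenvalues, so functionals take complex values even on real \<open>omega\<close>. The kernel of
  such a \<open>g\<close> may have real codimension 2, and then an \<open>f\<close> outside the span
  of \<open>g\<close> need not admit a vector \<open>y\<close> with \<open>g y = 0\<close> and
  \<open>f y \<noteq> 0\<close>; \<open>f\<close> has to avoid the span of \<open>g\<close> and its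
  conjugate. This is why three coordinates start the construction: they cannot all lie in a span of
  two functionals. Leaving the larger span costs a conjugate term in \<open>f \<circ> S t\<close>,
  which one further operator of the commuting family removes. Second, the line in the closure comes
  from the vectors \<open>x + u y\<close>, where \<open>x\<close> has the dense orbit: there
  \<open>f / g\<close> takes the values \<open>f x / g x + u (f y / g x)\<close>. Real
  \<open>u\<close> are available over both fields, and so the planar lemma excludes a line rather
  than the whole plane.\<close>

no_notation vector_scalar_mult (infixl "*s" 70)

text \<open>The space is a module over the polynomial ring, with the variable acting as
  \<open>A\<close>. The setting is abstract because it is used for \<open>T\<close>, for its dual
  operator and for pullbacks along a semigroup.\<close>

locale linear_endomorphism = vector_space scale
  for scale :: "'a::field \<Rightarrow> 'b::ab_group_add \<Rightarrow> 'b" (infixr "*s" 75) +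
  fixes A :: "'b \<Rightarrow> 'b"
  assumes lin: "Vector_Spaces.linear scale scale A"
begin

definition poly_act :: "'a poly \<Rightarrow> 'b \<Rightarrow> 'b" where
  "poly_act p x = (\<Sum>i\<le>degree p. coeff p i *s (A ^^ i) x)"

lemma poly_act_bound:
  assumes "degree p \<le> n"
  shows "poly_act p x = (\<Sum>i\<le>n. coeff p i *s (A ^^ i) x)"
  unfolding poly_act_def
  by (rule sum.mono_neutral_left) (use assms in \<open>auto simp: coeff_eq_0 not_le\<close>)

lemma poly_act_0 [simp]: "poly_act 0 x = 0"
  by (simp add: poly_act_def)

lemma poly_act_add: "poly_act (p + q) x = poly_act p x + poly_act q x"
proof -
  let ?n = "max (degree p) (degree q)"
  have "degree (p + q) \<le> ?n" by (rule degree_add_le) auto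
  then show ?thesis
    by (simp add: poly_act_bound[of _ ?n] scale_left_distrib sum.distrib)
qed

lemma poly_act_smult: "poly_act (smult c p) x = c *s poly_act p x"
  by (simp add: poly_act_bound[of _ "degree p"] degree_smult_le scale_sum_right)

lemma poly_act_sum: "poly_act (sum p I) x = (\<Sum>i\<in>I. poly_act (p i) x)"
  by (induction I rule: infinite_finite_induct) (auto simp: poly_act_add)

lemma poly_act_monom: "poly_act (monom c n) x = c *s (A ^^ n) x"
proof -
  have "poly_act (monom c n) x = (\<Sum>i\<le>n. if n = i then c *s (A ^^ i) x else 0)"
    unfolding poly_act_bound[OF degree_monom_le]
    by (rule sum.cong) auto
  then show ?thesis by simp
qed

lemma poly_act_minus: "poly_act (- p) x = - poly_act p x"
  using poly_act_smult[of "- 1" p x] by simp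

lemma poly_act_diff: "poly_act (p - q) x = poly_act p x - poly_act q x"
  using poly_act_add[of p "- q" x] by (simp add: poly_act_minus)

lemma linear_simps:
  "A 0 = 0" "A (x + y) = A x + A y" "A (x - y) = A x - A y" "A (c *s x) = c *s A x"
proof -
  have add: "A (x + y) = A x + A y" and scl: "A (c *s x) = c *s A x" for x y c
    using lin by (simp_all add: Vector_Spaces.linear_iff)
  show "A 0 = 0" using scl[of 0 0] by simp
  show "A (x + y) = A x + A y" "A (c *s x) = c *s A x" by (fact add scl)+
  show "A (x - y) = A x - A y"
    using add[of x "- y"] scl[of "- 1" y] by simp
qed

lemma linear_sum: "A (sum f I) = (\<Sum>i\<in>I. A (f i))"
  by (induction I rule: infinite_finite_induct) (auto simp: linear_simps)

text \<open>Horner's rule; it drives the inductions over polynomials that follow.\<close>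

lemma poly_act_pCons: "poly_act (pCons a p) x = a *s x + A (poly_act p x)"
proof -
  have "poly_act (pCons a p) x = (\<Sum>i\<le>Suc (degree p). coeff (pCons a p) i *s (A ^^ i) x)"
    by (rule poly_act_bound) (rule degree_pCons_le)
  also have "\<dots> = a *s x + A (poly_act p x)"
    unfolding sum.atMost_Suc_shift by (simp add: poly_act_def linear_sum linear_simps)
  finally show ?thesis .
qed

lemma poly_act_add_right: "poly_act p (x + y) = poly_act p x + poly_act p y"
  by (induction p) (auto simp: poly_act_pCons linear_simps scale_right_distrib)

lemma poly_act_scale_right: "poly_act p (c *s x) = c *s poly_act p x"
  by (induction p) (auto simp: poly_act_pCons linear_simps scale_right_distrib mult.commute)

lemma poly_act_zero_right: "poly_act p 0 = 0"
  using poly_act_scale_right[of p 0 0] by simp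

lemma poly_act_sum_right: "poly_act p (sum f I) = (\<Sum>i\<in>I. poly_act p (f i))"
  by (induction I rule: infinite_finite_induct)
    (auto simp: poly_act_add_right poly_act_zero_right)

lemma poly_act_mult: "poly_act (p * q) x = poly_act p (poly_act q x)"
  by (induction p) (auto simp: poly_act_pCons poly_act_add poly_act_smult)

lemma poly_act_in_subspace:
  assumes "subspace W" "\<And>y. y \<in> W \<Longrightarrow> A y \<in> W" "x \<in> W"
  shows "poly_act p x \<in> W"
  by (induction p) (auto simp: poly_act_pCons assms subspace_0 subspace_add subspace_scale)

text \<open>For finite \<open>G\<close> this is linear independence over the polynomial
  ring.\<close>

definition poly_free :: "'b set \<Rightarrow> bool" where
  "poly_free G \<longleftrightarrow> (\<forall>c. (\<Sum>g\<in>G. poly_act (c g) g) = 0 \<longrightarrow> (\<forall>g\<in>G. c g = 0))"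

text \<open>Over the field of fractions a maximal independent part \<open>G\<close> of
  \<open>B\<close> would be a basis of the span; \<open>q\<close> is a common denominator of the
  coordinates of the vectors of \<open>B\<close>.\<close>

lemma ex_poly_free:
  assumes "finite B"
  shows "\<exists>G q. finite G \<and> poly_free G \<and> q \<noteq> 0 \<and>
           (\<forall>b\<in>B. \<exists>c. poly_act q b = (\<Sum>g\<in>G. poly_act (c g) g))"
  using assms
proof (induction B rule: finite_induct)
  case empty
  show ?case by (rule exI[of _ "{}"], rule exI[of _ 1]) (auto simp: poly_free_def)
next
  case (insert b B)
  then obtain G q where G: "finite G" "poly_free G" "q \<noteq> 0"
    and rep: "\<And>b. b \<in> B \<Longrightarrow> \<exists>c. poly_act q b = (\<Sum>g\<in>G. poly_act (c g) g)"
    by blast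
  have gen: "\<exists>c. poly_act p b' = (\<Sum>g\<in>G. poly_act (c g) g)"
    if "b' \<in> B" "q dvd p" for b' p
  proof -
    from rep[OF that(1)] obtain c where c: "poly_act q b' = (\<Sum>g\<in>G. poly_act (c g) g)" by blast
    from that(2) obtain r where "p = r * q" by (metis dvdE mult.commute)
    then have "poly_act p b' = (\<Sum>g\<in>G. poly_act (r * c g) g)"
      by (simp add: poly_act_mult c poly_act_sum_right)
    then show ?thesis by (rule exI[of _ "\<lambda>g. r * c g"])
  qed
  show ?case
  proof (cases "b \<notin> G \<and> poly_free (insert b G)")
    case True
    have "\<exists>c. poly_act q b' = (\<Sum>g\<in>insert b G. poly_act (c g) g)" if "b' \<in> insert b B" for b'
    proof (cases "b' = b")
      case True': True
      have "(\<Sum>g\<in>insert b G. poly_act (if g = b then q else 0) g) =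
            poly_act q b + (\<Sum>g\<in>G. poly_act (if g = b then q else 0) g)"
        using True G(1) by simp
      also have "(\<Sum>g\<in>G. poly_act (if g = b then q else 0) g) = 0"
        using True by (intro sum.neutral) auto
      finally show ?thesis using True' by (intro exI[of _ "\<lambda>g. if g = b then q else 0"]) simp
    next
      case False
      with that gen[of b' q] obtain c where c: "poly_act q b' = (\<Sum>g\<in>G. poly_act (c g) g)"
        by auto
      have "(\<Sum>g\<in>insert b G. poly_act ((c(b := 0)) g) g) = (\<Sum>g\<in>G. poly_act ((c(b := 0)) g) g)"
        using True G(1) by simp
      also have "\<dots> = (\<Sum>g\<in>G. poly_act (c g) g)"
        using True by (intro sum.cong) auto
      finally show ?thesis using c by metis
    qed
    then show ?thesis using True G by blast
  next
    case False
    \<comment> \<open>A relation showing that \<open>b\<close> cannot be adjoined has a non-zero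
      coefficient at \<open>b\<close>, since \<open>G\<close> alone is free. That coefficient serves
      as \<open>r\<close> (and 1 does if \<open>b\<close> is already in \<open>G\<close>), and
      \<open>q * r\<close> becomes the new denominator.\<close>
    have "\<exists>r\<noteq>0. \<exists>c. poly_act r b = (\<Sum>g\<in>G. poly_act (c g) g)"
    proof (cases "b \<in> G")
      case True
      have "(\<Sum>g\<in>G. poly_act (if g = b then 1 else 0) g) =
            (\<Sum>g\<in>G. if g = b then poly_act 1 g else 0)"
        by (intro sum.cong) auto
      then have "poly_act 1 b = (\<Sum>g\<in>G. poly_act (if g = b then 1 else 0) g)"
        using True G(1) by simp
      then show ?thesis
        by (intro exI[of _ 1] conjI exI[of _ "\<lambda>g. if g = b then 1 else 0"]) auto
    next
      case nb: False
      with False obtain c where c: "(\<Sum>g\<in>insert b G. poly_act (c g) g) = 0"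
        and nz: "\<exists>g\<in>insert b G. c g \<noteq> 0"
        by (auto simp: poly_free_def)
      have eq: "poly_act (c b) b + (\<Sum>g\<in>G. poly_act (c g) g) = 0"
        using c nb G(1) by simp
      have "c b \<noteq> 0"
        using eq nz G(2) by (auto simp: poly_free_def)
      moreover have "poly_act (c b) b = (\<Sum>g\<in>G. poly_act (- c g) g)"
        using eq by (simp add: poly_act_minus sum_negf eq_neg_iff_add_eq_0)
      ultimately show ?thesis by (intro exI[of _ "c b"] conjI exI[of _ "\<lambda>g. - c g"])
    qed
    then obtain r c where r: "r \<noteq> 0" "poly_act r b = (\<Sum>g\<in>G. poly_act (c g) g)" by blast
    have "poly_act (q * r) b = (\<Sum>g\<in>G. poly_act (q * c g) g)"
      by (simp add: poly_act_mult r poly_act_sum_right)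
    then have "\<exists>c. poly_act (q * r) b = (\<Sum>g\<in>G. poly_act (c g) g)"
      by (rule exI[of _ "\<lambda>g. q * c g"])
    then have "\<forall>b'\<in>insert b B. \<exists>c. poly_act (q * r) b' = (\<Sum>g\<in>G. poly_act (c g) g)"
      using gen by simp
    moreover have "q * r \<noteq> 0" using r(1) G(3) by simp
    ultimately show ?thesis using G by blast
  qed
qed

text \<open>After multiplication by a common denominator, the span lies in a free module over the
  polynomial ring, with coordinates of bounded degree; multiplication by \<open>p\<close> raises the degree of
  the coordinates by the degree of \<open>p\<close>.\<close>

lemma degree_bound_of_torsion_free:
  assumes "finite B"
    and torsion: "\<And>x q. x \<in> span B \<Longrightarrow> q \<noteq> 0 \<Longrightarrow> poly_act q x = 0 \<Longrightarrow> x = 0"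
  shows "\<exists>m. \<forall>p x. x \<in> span B \<longrightarrow> x \<noteq> 0 \<longrightarrow> poly_act p x \<in> span B \<longrightarrow> degree p \<le> m"
proof -
  obtain G q where G: "finite G" "poly_free G" "q \<noteq> 0"
    and rep: "\<forall>b\<in>B. \<exists>c. poly_act q b = (\<Sum>g\<in>G. poly_act (c g) g)"
    using ex_poly_free[OF assms(1)] by blast
  from bchoice[OF rep] obtain c
    where c: "\<And>b. b \<in> B \<Longrightarrow> poly_act q b = (\<Sum>g\<in>G. poly_act (c b g) g)" by blast
  define m where "m = (\<Sum>b\<in>B. \<Sum>g\<in>G. degree (c b g))"
  have deg: "degree (c b g) \<le> m" if "b \<in> B" "g \<in> G" for b g
  proof -
    have "degree (c b g) \<le> (\<Sum>g\<in>G. degree (c b g))"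
      using G(1) that by (intro member_le_sum) auto
    also have "\<dots> \<le> m"
      unfolding m_def using assms(1) that by (intro member_le_sum[where f = "\<lambda>b. \<Sum>g\<in>G. degree (c b g)"]) auto
    finally show ?thesis .
  qed
  have coord: "\<exists>d. (\<forall>g\<in>G. degree (d g) \<le> m) \<and> poly_act q x = (\<Sum>g\<in>G. poly_act (d g) g)"
    if x: "x \<in> span B" for x
  proof -
    from x obtain u where u: "x = (\<Sum>b\<in>B. u b *s b)"
      using span_finite[OF assms(1)] by auto
    let ?d = "\<lambda>g. \<Sum>b\<in>B. smult (u b) (c b g)"
    have "\<forall>g\<in>G. degree (?d g) \<le> m"
      using assms(1) deg by (auto intro!: degree_sum_le order.trans[OF degree_smult_le])
    moreover have "poly_act q x = (\<Sum>b\<in>B. u b *s (\<Sum>g\<in>G. poly_act (c b g) g))"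
      by (simp add: u poly_act_sum_right poly_act_scale_right c)
    moreover have "\<dots> = (\<Sum>g\<in>G. poly_act (?d g) g)"
      by (simp add: poly_act_sum poly_act_smult scale_sum_right sum.swap[of _ B])
    ultimately show ?thesis by auto
  qed
  have "degree p \<le> m" if x: "x \<in> span B" "x \<noteq> 0" and y: "poly_act p x \<in> span B" for p x
  proof -
    obtain d where d: "poly_act q x = (\<Sum>g\<in>G. poly_act (d g) g)"
      using coord[OF x(1)] by blast
    obtain e where e: "\<And>g. g \<in> G \<Longrightarrow> degree (e g) \<le> m"
      "poly_act q (poly_act p x) = (\<Sum>g\<in>G. poly_act (e g) g)"
      using coord[OF y] by blast
    have "poly_act q (poly_act p x) = poly_act p (poly_act q x)"
      by (metis poly_act_mult mult.commute)
    also have "\<dots> = (\<Sum>g\<in>G. poly_act (p * d g) g)"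
      by (simp add: d poly_act_sum_right poly_act_mult)
    finally have "(\<Sum>g\<in>G. poly_act (p * d g - e g) g) = 0"
      by (simp add: e(2) poly_act_diff sum_subtractf)
    then have eq: "p * d g = e g" if "g \<in> G" for g
      using G(2) that by (fastforce simp: poly_free_def)
    \<comment> \<open>Torsion-freeness enters here: some coordinate \<open>d g\<close> is non-zero,
      and for \<open>p \<noteq> 0\<close> the degree of \<open>p\<close> is then at most that of
      \<open>p * d g = e g\<close>.\<close>
    have "poly_act q x \<noteq> 0" using torsion x G(3) by blast
    then obtain g where g: "g \<in> G" "d g \<noteq> 0"
      unfolding d by (metis (mono_tags, lifting) poly_act_0 sum.neutral)
    show ?thesis
    proof (cases "p = 0")
      case False
      then have "degree p \<le> degree (p * d g)" using g by (simp add: degree_mult_eq)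
      then show ?thesis using eq e(1) g(1) by (metis order.trans)
    qed simp
  qed
  then show ?thesis by blast
qed

text \<open>The \<open>card B + 1\<close> iterates up to \<open>card B\<close> are dependent. A
  repetition among them is invisible in their set, so it is treated apart and yields a difference of
  two monomials.\<close>

lemma ex_annihilating_poly:
  assumes "finite B" "\<And>i. (A ^^ i) x \<in> span B"
  shows "\<exists>p. p \<noteq> 0 \<and> poly_act p x = 0"
proof (cases "inj_on (\<lambda>i. (A ^^ i) x) {..card B}")
  case True
  let ?v = "\<lambda>i. (A ^^ i) x"
  have "dependent (?v ` {..card B})"
  proof (rule ccontr)
    assume "independent (?v ` {..card B})"
    then have "card (?v ` {..card B}) \<le> card B"
      using independent_span_bound[OF assms(1)] assms(2) by blast
    then show False using True by (simp add: card_image)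
  qed
  then obtain u i where u: "i \<le> card B" "u (?v i) \<noteq> 0" "(\<Sum>w\<in>?v ` {..card B}. u w *s w) = 0"
    by (subst (asm) dependent_finite) auto
  let ?p = "\<Sum>i\<le>card B. monom (u (?v i)) i"
  have "coeff ?p i = u (?v i)" using u(1) by (simp add: coeff_sum)
  then have "?p \<noteq> 0" using u(2) by (metis coeff_0)
  moreover have "poly_act ?p x = 0"
    using u(3) True by (simp add: poly_act_sum poly_act_monom sum.reindex)
  ultimately show ?thesis by blast
next
  case False
  then obtain i j where ij: "i \<noteq> j" "(A ^^ i) x = (A ^^ j) x" by (auto simp: inj_on_def)
  then have "monom 1 i - monom 1 j \<noteq> (0 :: 'a poly)" by (simp add: monom_eq_iff')
  moreover have "poly_act (monom 1 i - monom 1 j) x = 0"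
    using ij by (simp add: poly_act_diff poly_act_monom)
  ultimately show ?thesis by blast
qed

end

section \<open>Linear algebra: dimension, interpolation, common eigenvectors\<close>

context vector_space
begin

text \<open>The finite spanning set matters: \<open>dim\<close> is the cardinality of a basis, and
  \<open>card\<close> is 0 on infinite sets.\<close>

lemma dim_less_of_psubset:
  assumes "subspace M" "M \<subset> N" "N \<subseteq> span B" "finite B"
  shows "dim M < dim N"
proof -
  obtain C where C: "C \<subseteq> M" "independent C" "M \<subseteq> span C" "card C = dim M"
    using basis_exists[of M] by blast
  obtain x where x: "x \<in> N" "x \<notin> M" using assms(2) by blast
  have "x \<notin> span C" using x(2) C(1) assms(1) span_minimal by blast
  then have ind: "independent (insert x C)" using C(2) by (rule independent_insertI)
  have sub: "insert x C \<subseteq> N" using x C(1) assms(2) by blast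
  obtain D where D: "insert x C \<subseteq> D" "D \<subseteq> N" "independent D" "N \<subseteq> span D"
    using maximal_independent_subset_extend[OF sub ind] by blast
  have fin: "finite D" using independent_span_bound[OF assms(4) D(3)] D(2) assms(3) by blast
  have "dim N = card D" using D by (intro dim_unique[of D]) auto
  moreover have "card (insert x C) \<le> card D" using D(1) fin by (rule card_mono[rotated])
  moreover have "card (insert x C) = Suc (card C)"
    using \<open>x \<notin> span C\<close> span_base finite_subset[OF D(1) fin] by (subst card_insert_disjoint) auto
  ultimately show ?thesis using C(4) by simp
qed

text \<open>Independent functionals map onto the space of all value vectors. They form an indexed
  family and not a set, so that two equal functionals count as dependent.\<close>

lemma ex_prescribed_values:
  fixes h :: "'j \<Rightarrow> 'b \<Rightarrow> 'a"
  assumes "finite J"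
    and add: "\<And>j x y. h j (x + y) = h j x + h j y" and scl: "\<And>j c x. h j (c *s x) = c * h j x"
    and "\<And>c. (\<And>x. (\<Sum>j\<in>J. c j * h j x) = 0) \<Longrightarrow> \<forall>j\<in>J. c j = 0"
  shows "\<exists>x. \<forall>j\<in>J. h j x = b j"
  using assms(1,4)
proof (induction J arbitrary: b rule: finite_induct)
  case empty
  then show ?case by simp
next
  case (insert k J)
  have zero: "h j 0 = 0" for j using scl[of j 0 0] by simp
  have hsum: "h j (\<Sum>i\<in>I. c i *s y i) = (\<Sum>i\<in>I. c i * h j (y i))" for j c y and I :: "'j set"
    by (induction I rule: infinite_finite_induct) (auto simp: add scl zero)
  have "\<forall>j\<in>J. c j = 0" if c: "\<And>x. (\<Sum>j\<in>J. c j * h j x) = 0" for c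
  proof -
    have "(\<Sum>j\<in>insert k J. (c(k := 0)) j * h j x) = 0" for x
    proof -
      have "(\<Sum>j\<in>insert k J. (c(k := 0)) j * h j x) = (\<Sum>j\<in>J. (c(k := 0)) j * h j x)"
        using insert.hyps by simp
      also have "\<dots> = (\<Sum>j\<in>J. c j * h j x)"
        using insert.hyps by (intro sum.cong) auto
      finally show ?thesis using c by simp
    qed
    then have "\<forall>j\<in>insert k J. (c(k := 0)) j = 0" by (rule insert.prems)
    then show ?thesis using insert.hyps by (metis fun_upd_other insertCI)
  qed
  note IH = insert.IH[OF this]
  \<comment> \<open>Vectors dual to the functionals in \<open>J\<close>; for them the induction
    leaves the prescribed values arbitrary.\<close>
  have "\<exists>y. \<forall>i\<in>J. h i y = (if i = j then 1 else 0)" for j by (rule IH)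
  then obtain y where y: "\<And>j i. i \<in> J \<Longrightarrow> h i (y j) = (if i = j then 1 else 0)" by metis
  have "\<exists>z. (\<forall>j\<in>J. h j z = 0) \<and> h k z \<noteq> 0"
  proof (rule ccontr)
    assume no: "\<not> ?thesis"
    have "h k x = (\<Sum>j\<in>J. h k (y j) * h j x)" for x
    proof -
      \<comment> \<open>The projection of \<open>x\<close> to the common kernel of the functionals
        in \<open>J\<close>. If \<open>h k\<close> vanished on that kernel, it would be a
        combination of the others.\<close>
      let ?z = "x + (\<Sum>j\<in>J. (- h j x) *s y j)"
      have "h i ?z = 0" if "i \<in> J" for i
      proof -
        have "h i ?z = h i x + (\<Sum>j\<in>J. if j = i then - h j x else 0)"
          unfolding add hsum using that by (intro arg_cong2[where f = plus] sum.cong) (auto simp: y)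
        then show ?thesis using that insert.hyps by simp
      qed
      then have "h k ?z = 0" using no by blast
      then show ?thesis
        unfolding add hsum by (simp add: sum_negf mult.commute)
    qed
    then have "(\<Sum>j\<in>insert k J. (if j = k then - 1 else h k (y j)) * h j x) = 0" for x
    proof -
      have "(\<Sum>j\<in>J. (if j = k then - 1 else h k (y j)) * h j x) = (\<Sum>j\<in>J. h k (y j) * h j x)"
        using insert.hyps by (intro sum.cong) auto
      then show ?thesis using insert.hyps \<open>h k x = _\<close> by simp
    qed
    from insert.prems[OF this] show False by auto
  qed
  then obtain z where z: "\<And>j. j \<in> J \<Longrightarrow> h j z = 0" "h k z \<noteq> 0" by blast
  obtain x where x: "\<And>j. j \<in> J \<Longrightarrow> h j x = b j" using IH by blast
  show ?case
    by (rule exI[of _ "x + ((b k - h k x) / h k z) *s z"]) (auto simp: add scl x z)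
qed

end

text \<open>A common eigenvector in the quotient \<open>E / W\<close>, expressed by representatives.
  The family may be infinite, so the argument uses an invariant \<open>M\<close> of least dimension
  strictly above \<open>W\<close>: each operator has an eigenvalue on \<open>M / W\<close>, its
  eigenspace is invariant by commutativity and hence is everything. Any vector of
  \<open>M - W\<close> therefore serves all operators at once.\<close>

lemma common_eigenvector_mod:
  fixes W E :: "('i \<Rightarrow> complex) set"
  assumes W: "fun_space.subspace W" and E: "fun_space.subspace E" and "W \<subset> E"
    and B: "finite B" "E \<subseteq> fun_space.span B"
    and lin: "\<And>A. A \<in> \<A> \<Longrightarrow> Vector_Spaces.linear fscale fscale A"
    and AW: "\<And>A f. A \<in> \<A> \<Longrightarrow> f \<in> W \<Longrightarrow> A f \<in> W"
    and AE: "\<And>A f. A \<in> \<A> \<Longrightarrow> f \<in> E \<Longrightarrow> A f \<in> E"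
    and comm: "\<And>A A' f. A \<in> \<A> \<Longrightarrow> A' \<in> \<A> \<Longrightarrow> A (A' f) = A' (A f)"
  shows "\<exists>f\<in>E - W. \<forall>A\<in>\<A>. \<exists>b. A f - fscale b f \<in> W"
proof -
  let ?P = "\<lambda>M. fun_space.subspace M \<and> W \<subset> M \<and> M \<subseteq> E \<and> (\<forall>A\<in>\<A>. \<forall>f\<in>M. A f \<in> M)"
  have PE: "?P E" using E \<open>W \<subset> E\<close> AE by auto
  then obtain M where M: "?P M" and min: "\<And>N. ?P N \<Longrightarrow> fun_space.dim M \<le> fun_space.dim N"
    using ex_has_least_nat[of ?P E fun_space.dim, OF PE] by (elim exE conjE) auto
  obtain f0 where f0: "f0 \<in> M" "f0 \<notin> W" using M by blast
  have "\<exists>b. A f0 - fscale b f0 \<in> W" if A: "A \<in> \<A>" for A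
  proof -
    interpret A: linear_endomorphism fscale A
      using lin[OF A] by (simp add: linear_endomorphism_def linear_endomorphism_axioms_def
          fun_space.vector_space_axioms)
    have AM: "A f \<in> M" if "f \<in> M" for f using that M A by blast
    have "(A ^^ i) f0 \<in> M" for i by (induction i) (auto simp: f0 AM)
    then have "(A ^^ i) f0 \<in> fun_space.span B" for i using M B(2) by blast
    then obtain p0 where p0: "p0 \<noteq> 0" "A.poly_act p0 f0 = 0"
      using A.ex_annihilating_poly[OF B(1)] by blast
    \<comment> \<open>A polynomial of least degree carrying some vector of \<open>M - W\<close> into
      \<open>W\<close>. Splitting off a root \<open>b\<close> leaves a factor that, by minimality,
      keeps the vector outside \<open>W\<close>; its image is an eigenvector modulo
      \<open>W\<close>.\<close>
    let ?Q = "\<lambda>p. p \<noteq> 0 \<and> (\<exists>f\<in>M - W. A.poly_act p f \<in> W)"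
    have Q0: "?Q p0" using p0 f0 fun_space.subspace_0[OF W] by (intro conjI bexI[of _ f0]) auto
    then obtain p where p: "?Q p" and minp: "\<And>q. ?Q q \<Longrightarrow> degree p \<le> degree q"
      using ex_has_least_nat[of ?Q p0 degree, OF Q0] by (elim exE conjE) auto
    then obtain f where f: "f \<in> M" "f \<notin> W" "A.poly_act p f \<in> W" by blast
    have "degree p \<noteq> 0"
    proof
      assume "degree p = 0"
      then obtain c where c: "p = [:c:]" by (rule degree_eq_zeroE)
      then have "c \<noteq> 0" using p by auto
      have "fscale c f \<in> W"
        using f(3) by (simp add: c A.poly_act_pCons A.linear_simps)
      then have "fscale (inverse c) (fscale c f) \<in> W"
        using W fun_space.subspace_scale by blast
      then show False using f(2) \<open>c \<noteq> 0\<close> by (simp add: fun_space.scale_scale)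
    qed
    then have "\<not> constant (poly p)" by (simp add: constant_degree)
    then obtain b where "poly p b = 0" using fundamental_theorem_of_algebra by blast
    then obtain q where q: "p = [:- b, 1:] * q" by (auto simp: poly_eq_0_iff_dvd dvd_def)
    have "q \<noteq> 0" using p q by auto
    then have "degree p = Suc (degree q)" by (subst q, subst degree_mult_eq) auto
    let ?f = "A.poly_act q f"
    have "?f \<in> M" using M by (intro A.poly_act_in_subspace AM f(1)) auto
    moreover have "?f \<notin> W"
      using minp[of q] \<open>q \<noteq> 0\<close> f \<open>degree p = _\<close> by auto
    moreover have "A.poly_act p f = A ?f - fscale b ?f"
      unfolding q A.poly_act_mult
      by (simp add: A.poly_act_pCons A.linear_simps)
    ultimately have f': "?f \<in> M - W" "A ?f - fscale b ?f \<in> W" using f(3) by auto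
    \<comment> \<open>The preimage in \<open>M\<close> of the eigenspace for \<open>b\<close> in
      \<open>M / W\<close>; minimality of \<open>M\<close> forces it to be \<open>M\<close>.\<close>
    let ?N = "{h \<in> M. A h - fscale b h \<in> W}"
    have Nsub: "fun_space.subspace ?N"
    proof (rule fun_space.subspaceI)
      show "0 \<in> ?N" using M W by (simp add: A.linear_simps fun_space.subspace_0)
    next
      fix x y assume xy: "x \<in> ?N" "y \<in> ?N"
      have "A (x + y) - fscale b (x + y) = (A x - fscale b x) + (A y - fscale b y)"
        by (simp add: A.linear_simps fun_space.scale_right_distrib algebra_simps)
      then show "x + y \<in> ?N" using xy M W by (auto intro: fun_space.subspace_add)
    next
      fix c x assume x: "x \<in> ?N"
      have "A (fscale c x) - fscale b (fscale c x) = fscale c (A x - fscale b x)"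
        by (simp add: A.linear_simps fun_space.scale_right_diff_distrib mult.commute)
      then show "fscale c x \<in> ?N" using x M W by (auto intro: fun_space.subspace_scale)
    qed
    have WN: "W \<subset> ?N"
    proof -
      have "h \<in> ?N" if "h \<in> W" for h
        using that M AW[OF A] W by (auto intro: fun_space.subspace_diff fun_space.subspace_scale)
      then show ?thesis using f' by blast
    qed
    have NA: "\<forall>A'\<in>\<A>. \<forall>h\<in>?N. A' h \<in> ?N"
    proof (intro ballI)
      fix A' h assume A': "A' \<in> \<A>" and h: "h \<in> ?N"
      interpret A': linear_endomorphism fscale A'
        using lin[OF A'] by (simp add: linear_endomorphism_def linear_endomorphism_axioms_def
            fun_space.vector_space_axioms)
      have "A (A' h) - fscale b (A' h) = A' (A h - fscale b h)"
        by (simp add: A'.linear_simps comm[OF A A'])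
      then show "A' h \<in> ?N" using h A' M AW[OF A'] by auto
    qed
    have "?N \<subseteq> E" "M \<subseteq> fun_space.span B" using M B(2) by auto
    then have le: "fun_space.dim M \<le> fun_space.dim ?N"
      using Nsub WN NA by (intro min conjI)
    have "\<not> ?N \<subset> M"
    proof
      assume "?N \<subset> M"
      then have "fun_space.dim ?N < fun_space.dim M"
        using Nsub B(1) \<open>M \<subseteq> fun_space.span B\<close> by (intro fun_space.dim_less_of_psubset)
      then show False using le by simp
    qed
    then have "f0 \<in> ?N" using f0(1) by blast
    then show ?thesis by blast
  qed
  moreover have "f0 \<in> E - W" using f0 M by auto
  ultimately show ?thesis by blast
qed

section \<open>Universality\<close>

lemma sum_fun_apply: "(\<Sum>i\<in>I. f i) x = (\<Sum>i\<in>I. f i x)"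
  for f :: "'j \<Rightarrow> 'i \<Rightarrow> 'b::comm_monoid_add"
  by (induction I rule: infinite_finite_induct) auto

text \<open>Demanding equality of finitely many coordinates, and not mere closeness, turns
  approximation in \<open>omega\<close> into exact interpolation.\<close>

lemma open_contains_cylinder:
  fixes U :: "(nat \<Rightarrow> 'a::topological_space) set"
  assumes "open U" "u \<in> U"
  shows "\<exists>n. \<forall>y. (\<forall>i<n. y i = u i) \<longrightarrow> y \<in> U"
proof -
  obtain X where X: "u \<in> (\<Pi>\<^sub>E i\<in>UNIV. X i)" "finite {i. X i \<noteq> UNIV}" "(\<Pi>\<^sub>E i\<in>UNIV. X i) \<subseteq> U"
    using product_topology_open_contains_basis[of "\<lambda>_. euclidean" UNIV U u] assms
    by (auto simp: open_fun_def)
  obtain n where n: "\<And>i. X i \<noteq> UNIV \<Longrightarrow> i < n"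
    using finite_nat_bounded[OF X(2)] by auto
  have "y \<in> U" if "\<forall>i<n. y i = u i" for y
  proof -
    have "y i \<in> X i" for i
      using that n[of i] X(1) by (cases "X i = UNIV") (auto simp: PiE_iff)
    then show ?thesis using X(3) by (auto simp: PiE_iff)
  qed
  then show ?thesis by blast
qed

lemma omega_linear_iff:
  "Vector_Spaces.linear fscale fscale T \<longleftrightarrow>
    (\<forall>x y. T (x + y) = T x + T y) \<and> (\<forall>c x. T (fscale c x) = fscale c (T x))"
  by (simp add: Vector_Spaces.linear_iff fun_space.vector_space_axioms)

lemma functional_linear_iff:
  "Vector_Spaces.linear fscale (*) f \<longleftrightarrow>
    (\<forall>x y. f (x + y) = f x + f y) \<and> (\<forall>c x. f (fscale c x) = c * f x)"
  by (simp add: Vector_Spaces.linear_iff fun_space.vector_space_axioms vector_space_over_itself.vector_space_axioms)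

lemma linear_endomorphism_fscale:
  "linear_endomorphism fscale T \<longleftrightarrow> Vector_Spaces.linear fscale fscale T"
  by (simp add: linear_endomorphism_def linear_endomorphism_axioms_def fun_space.vector_space_axioms)

text \<open>For each non-empty basic open \<open>V\<close> the points that some \<open>F l\<close>
  sends into \<open>V\<close> form an open set, dense by transitivity; a point common to these
  countably many sets is universal. The sort \<open>polish_space\<close> of the scalars makes
  \<open>omega\<close> second countable and completely metrizable, and covers both fields.\<close>

lemma universal_if_transitive:
  fixes F :: "nat \<Rightarrow> 'k::{real_normed_field, polish_space} omega \<Rightarrow> 'k omega"
  assumes cont: "\<And>l. continuous_on UNIV (F l)"
    and trans: "\<And>U V. open U \<Longrightarrow> open V \<Longrightarrow> U \<noteq> {} \<Longrightarrow> V \<noteq> {} \<Longrightarrow> \<exists>l. \<exists>x\<in>U. F l x \<in> V"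
  shows "universal F"
proof -
  obtain \<B> :: "'k omega set set" where B: "countable \<B>" "topological_basis \<B>"
    using ex_countable_basis by blast
  define G where "G V = (\<Union>l. F l -` V)" for V
  have "euclidean closure_of (\<Inter>(G ` (\<B> - {{}}))) = topspace (euclidean :: 'k omega topology)"
  proof (rule Baire_category)
    show "completely_metrizable_space (euclidean :: 'k omega topology) \<or>
      locally_compact_space (euclidean :: 'k omega topology) \<and>
      regular_space (euclidean :: 'k omega topology)"
      by (simp add: completely_metrizable_space_euclidean)
    show "countable (G ` (\<B> - {{}}))" using B(1) by simp
  next
    fix S assume "S \<in> G ` (\<B> - {{}})"
    then obtain V where V: "V \<in> \<B>" "V \<noteq> {}" "S = G V" by blast
    have oV: "open V" using V B(2) by (simp add: topological_basis_open)
    have "open S" unfolding V G_def using cont oV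
      by (auto intro: open_vimage)
    moreover have "closure S = UNIV"
    proof (rule ccontr)
      assume "closure S \<noteq> UNIV"
      then have "- closure S \<noteq> {}" by blast
      then have "\<exists>l. \<exists>x\<in>- closure S. F l x \<in> V"
        using oV V(2) by (intro trans) (simp_all add: open_Compl)
      then obtain l x where x: "x \<notin> closure S" "F l x \<in> V" by auto
      then have "x \<in> S" unfolding V G_def by auto
      then show False using x(1) closure_subset by blast
    qed
    ultimately show "openin euclidean S \<and> euclidean closure_of S = topspace euclidean"
      by simp
  qed
  then have "closure (\<Inter>(G ` (\<B> - {{}}))) = UNIV" by simp
  then have "\<Inter>(G ` (\<B> - {{}})) \<noteq> {}" by (metis closure_empty UNIV_not_empty)
  then obtain x where "x \<in> \<Inter>(G ` (\<B> - {{}}))" by blast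
  then have x: "\<exists>l. F l x \<in> V" if "V \<in> \<B>" "V \<noteq> {}" for V
    using that by (auto simp: G_def)
  have "closure {F l x |l. True} = UNIV"
  proof (rule ccontr)
    assume "\<not> ?thesis"
    then obtain y where y: "y \<in> - closure {F l x |l. True}" by auto
    have "open (- closure {F l x |l. True})" by (simp add: open_Compl)
    then obtain V where V: "V \<in> \<B>" "y \<in> V" "V \<subseteq> - closure {F l x |l. True}"
      using topological_basisE[OF B(2) _ y] by metis
    then obtain l where "F l x \<in> V" using x[of V] by auto
    then have "F l x \<notin> closure {F l x |l. True}" using V(3) by auto
    then show False using closure_subset[of "{F l x |l. True}"] by auto
  qed
  then show ?thesis unfolding universal_def by blast
qed

section \<open>The dual of \<open>omega\<close> as a module over the polynomial ring\<close>

lemma dual_subspace: "fun_space.subspace (dual :: ('k::real_normed_field omega \<Rightarrow> 'k) set)"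
  by (rule fun_space.subspaceI)
    (auto simp: dual_def functional_linear_iff fscale_def algebra_simps plus_fun_def zero_fun_def
      intro!: continuous_intros)

lemma coordinate_in_dual: "(\<lambda>x. x i) \<in> dual"
  by (simp add: dual_def functional_linear_iff fscale_def)

lemma dual_op_in_dual:
  assumes "T \<in> operators" "f \<in> dual"
  shows "dual_op T f \<in> dual"
proof -
  have "continuous_on UNIV (\<lambda>x. f (T x))"
    using assms continuous_on_compose2[of UNIV f UNIV T] by (simp add: dual_def operators_def)
  then show ?thesis
    using assms by (simp add: dual_def operators_def functional_linear_iff omega_linear_iff dual_op_def)
qed

lemma linear_endomorphism_dual_op: "linear_endomorphism fscale (dual_op T)"
  by (auto simp: linear_endomorphism_fscale omega_linear_iff dual_op_def fscale_def plus_fun_def)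

lemma dual_op_pow: "(dual_op T ^^ i) f = (\<lambda>x. f ((T ^^ i) x))"
  by (induction i arbitrary: f) (auto simp: dual_op_def funpow_swap1)

context
  fixes T :: "'k::real_normed_field omega \<Rightarrow> 'k omega"
  assumes T: "T \<in> operators"
begin

interpretation T: linear_endomorphism fscale T
  using T by (simp add: operators_def linear_endomorphism_fscale)

interpretation D: linear_endomorphism fscale "dual_op T"
  by (rule linear_endomorphism_dual_op)

lemma poly_op_add: "poly_op p T (x + y) = poly_op p T x + poly_op p T y"
  and poly_op_fscale: "poly_op p T (fscale c x) = fscale c (poly_op p T x)"
  using T.poly_act_add_right[of p x y] T.poly_act_scale_right[of p c x]
  by (simp_all add: poly_op_def T.poly_act_def)

lemma continuous_on_poly_op: "continuous_on UNIV (poly_op p T)"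
proof -
  have "continuous_on UNIV (T ^^ i)" for i
  proof (induction i)
    case 0
    then show ?case by (simp add: id_def)
  next
    case (Suc i)
    have "continuous_on UNIV T" using T by (simp add: operators_def)
    then show ?case using Suc continuous_on_compose[of UNIV "T ^^ i" T]
      by (auto intro: continuous_on_subset)
  qed
  then have "continuous_on UNIV (\<lambda>x. (T ^^ i) x j)" for i j
    by (rule continuous_on_product_then_coordinatewise)
  then show ?thesis unfolding poly_op_def
    by (intro continuous_on_coordinatewise_then_product)
      (simp add: sum_fun_apply fscale_def continuous_intros)
qed

lemma dual_poly_act:
  assumes "f \<in> dual"
  shows "D.poly_act p f = (\<lambda>x. f (poly_op p T x))"
proof
  fix x
  have f: "f (x + y) = f x + f y" "f (fscale c x) = c * f x" for c x y
    using assms by (auto simp: dual_def functional_linear_iff)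
  have "f 0 = 0" using f(2)[of 0 0] by simp
  then have "f (sum g I) = (\<Sum>i\<in>I. f (g i))" for g and I :: "nat set"
    by (induction I rule: infinite_finite_induct) (auto simp: f)
  then show "D.poly_act p f x = f (poly_op p T x)"
    by (simp add: D.poly_act_def poly_op_def sum_fun_apply f dual_op_pow)
      (simp add: fscale_def)
qed

lemma torsion_free_dual:
  assumes noinv: "\<nexists>M. dual_invariant_subspace T M \<and> finite_dim M \<and> M \<noteq> {0}"
    and f: "f \<in> dual" and q: "q \<noteq> 0" and tors: "D.poly_act q f = 0"
  shows "f = 0"
proof (rule ccontr)
  assume "f \<noteq> 0"
  define d where "d = degree q"
  let ?v = "\<lambda>i. (dual_op T ^^ i) f"
  let ?M = "fun_space.span (?v ` {..<d})"
  have sum0: "(\<Sum>i<d. fscale (coeff q i) (?v i)) + fscale (coeff q d) (?v d) = 0"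
    using tors by (simp add: D.poly_act_def d_def lessThan_Suc_atMost[symmetric])
  have lc: "coeff q d \<noteq> 0" using q by (simp add: d_def)
  have "?v d = fscale (inverse (coeff q d)) (fscale (coeff q d) (?v d))"
    using lc by (simp add: fun_space.scale_scale)
  also have "fscale (coeff q d) (?v d) = - (\<Sum>i<d. fscale (coeff q i) (?v i))"
    using sum0 by (simp add: eq_neg_iff_add_eq_0 add.commute)
  finally have vd: "?v d = fscale (inverse (coeff q d)) (- (\<Sum>i<d. fscale (coeff q i) (?v i)))" .
  \<comment> \<open>The case \<open>i = d\<close> is included, by division by the leading
    coefficient. It gives the invariance of \<open>?M\<close>; for \<open>d = 0\<close> it puts
    \<open>f\<close> itself into the zero space.\<close>
  have vM: "?v i \<in> ?M" if "i \<le> d" for i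
  proof (cases "i = d")
    case True
    have "(\<Sum>i<d. fscale (coeff q i) (?v i)) \<in> ?M"
      by (intro fun_space.span_sum fun_space.span_scale fun_space.span_base) auto
    then show ?thesis unfolding True vd by (intro fun_space.span_scale fun_space.span_neg)
  next
    case False
    then show ?thesis using that by (intro fun_space.span_base) auto
  qed
  have "dual_op T x \<in> ?M" if "x \<in> ?M" for x
    using that
  proof (induction rule: fun_space.span_induct_alt)
    case base
    show ?case by (subst D.linear_simps(1)) (rule fun_space.span_zero)
  next
    case (step c x y)
    then obtain i where "i < d" "x = ?v i" by auto
    then have "dual_op T x \<in> ?M" using vM[of "Suc i"] by simp
    then show ?case
      unfolding D.linear_simps using step(2) by (intro fun_space.span_add fun_space.span_scale)
  qed
  moreover have "?v i \<in> dual" for i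
    by (induction i) (auto simp: f dual_op_in_dual T)
  then have "?M \<subseteq> dual" by (intro fun_space.span_minimal dual_subspace) auto
  ultimately have "dual_invariant_subspace T ?M"
    by (auto simp: dual_invariant_subspace_def)
  moreover have "finite_dim ?M" unfolding finite_dim_def by blast
  moreover have "?M \<noteq> {0}" using vM[of 0] \<open>f \<noteq> 0\<close> by auto
  ultimately show False using noinv by blast
qed

text \<open>A relation among the \<open>2 n\<close> functionals reads \<open>f + p(T') g = 0\<close>
  with \<open>f\<close> and \<open>g\<close> in the span of the coordinates; the degree bound forces
  \<open>g = 0\<close>, and then \<open>f = 0\<close>. The bound \<open>m\<close> does not depend on
  the prescribed values.\<close>

lemma ex_prescribed_coordinates:
  assumes noinv: "\<nexists>M. dual_invariant_subspace T M \<and> finite_dim M \<and> M \<noteq> {0}"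
  shows "\<exists>m. \<forall>p. degree p > m \<longrightarrow> (\<forall>a b. \<exists>x. \<forall>i<n. x i = a i \<and> poly_op p T x i = b i)"
proof -
  let ?e = "\<lambda>i (x :: 'k omega). x i"
  let ?B = "?e ` {..<n}"
  have Bdual: "fun_space.span ?B \<subseteq> dual"
    by (intro fun_space.span_minimal dual_subspace) (auto intro: coordinate_in_dual)
  obtain m where m: "\<And>p f. f \<in> fun_space.span ?B \<Longrightarrow> f \<noteq> 0 \<Longrightarrow>
      D.poly_act p f \<in> fun_space.span ?B \<Longrightarrow> degree p \<le> m"
    using D.degree_bound_of_torsion_free[of ?B] torsion_free_dual[OF noinv] Bdual by blast
  have "\<exists>x. \<forall>i<n. x i = a i \<and> poly_op p T x i = b i" if p: "degree p > m" for p a b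
  proof -
    \<comment> \<open>The left summand indexes the coordinates of \<open>x\<close>, the right one
      those of \<open>poly_op p T x\<close>.\<close>
    let ?J = "{..<n} <+> {..<n}"
    define h where "h j x = (case j of Inl i \<Rightarrow> x i | Inr i \<Rightarrow> poly_op p T x i)" for j x
    have "\<exists>x. \<forall>j\<in>?J. h j x = case_sum a b j"
    proof (rule fun_space.ex_prescribed_values)
      show "finite ?J" by simp
      show "h j (x + y) = h j x + h j y" for j x y
        by (auto simp: h_def poly_op_add split: sum.split)
      show "h j (fscale c x) = c * h j x" for j c x
        by (auto simp: h_def poly_op_fscale split: sum.split) (auto simp: fscale_def)
      fix c assume c: "\<And>x. (\<Sum>j\<in>?J. c j * h j x) = 0"
      have inB: "(\<Sum>i<n. fscale (d i) (?e i)) \<in> fun_space.span ?B" for d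
        by (intro fun_space.span_sum fun_space.span_scale fun_space.span_base) auto
      let ?f = "\<Sum>i<n. fscale (c (Inl i)) (?e i)" and ?g = "\<Sum>i<n. fscale (c (Inr i)) (?e i)"
      have app: "(\<Sum>i<n. fscale (d i) (?e i)) x = (\<Sum>i<n. d i * x i)" for d x
        by (simp add: sum_fun_apply fscale_def)
      \<comment> \<open>Evaluation at the \<open>i\<close>-th unit vector.\<close>
      have coeff0: "d i = 0" if "(\<Sum>i<n. fscale (d i) (?e i)) = 0" "i < n" for d :: "nat \<Rightarrow> 'k" and i
      proof -
        have "0 = (\<Sum>j<n. d j * (if j = i then 1 else 0))"
          unfolding app[symmetric] that by simp
        also have "\<dots> = (\<Sum>j<n. if j = i then d j else 0)"
          by (intro sum.cong) auto
        finally show ?thesis using that(2) by simp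
      qed
      have "D.poly_act p ?g = (\<lambda>x. ?g (poly_op p T x))"
        by (rule dual_poly_act[OF subsetD[OF Bdual inB]])
      then have "?f + D.poly_act p ?g = 0"
        using c by (auto simp: fun_eq_iff app h_def sum.Plus)
      then have "D.poly_act p ?g = - ?f" by (simp add: eq_neg_iff_add_eq_0 add.commute)
      then have "D.poly_act p ?g \<in> fun_space.span ?B" using inB by (simp add: fun_space.span_neg)
      then have g0: "?g = 0" using m[of ?g p] inB p by force
      then have "?f = 0" using \<open>?f + D.poly_act p ?g = 0\<close> by (simp add: D.poly_act_zero_right)
      then show "\<forall>j\<in>?J. c j = 0" using g0 coeff0 by auto
    qed
    then obtain x where x: "\<forall>j\<in>?J. h j x = case_sum a b j" by blast
    have "x i = a i \<and> poly_op p T x i = b i" if "i < n" for i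
      using bspec[OF x, of "Inl i"] bspec[OF x, of "Inr i"] that by (simp add: h_def InlI InrI)
    then show ?thesis by blast
  qed
  then show ?thesis by blast
qed

end

proposition universal_poly_op:
  fixes T :: "'k::{real_normed_field, polish_space} omega \<Rightarrow> 'k omega"
  assumes T: "T \<in> operators"
    and noinv: "\<nexists>M. dual_invariant_subspace T M \<and> finite_dim M \<and> M \<noteq> {0}"
    and deg: "filterlim (\<lambda>l. degree (p l)) at_top sequentially"
  shows "universal (\<lambda>l. poly_op (p l) T)"
proof (rule universal_if_transitive)
  show "continuous_on UNIV (poly_op (p l) T)" for l
    using T by (rule continuous_on_poly_op)
next
  fix U V :: "'k omega set" assume UV: "open U" "open V" "U \<noteq> {}" "V \<noteq> {}"
  obtain u v where uv: "u \<in> U" "v \<in> V" using UV by blast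
  obtain n1 n2 where n1: "\<forall>y. (\<forall>i<n1. y i = u i) \<longrightarrow> y \<in> U"
    and n2: "\<forall>y. (\<forall>i<n2. y i = v i) \<longrightarrow> y \<in> V"
    using open_contains_cylinder UV uv by metis
  obtain m where m: "\<And>p a b. degree p > m \<Longrightarrow>
      \<exists>x. \<forall>i<max n1 n2. x i = a i \<and> poly_op p T x i = b i"
    using ex_prescribed_coordinates[OF T noinv] by blast
  have "\<forall>\<^sub>F l in sequentially. degree (p l) \<ge> Suc m"
    using deg by (simp only: filterlim_at_top)
  then obtain l where "degree (p l) > m"
    by (auto simp: eventually_sequentially Suc_le_eq)
  then obtain x where "\<forall>i<max n1 n2. x i = u i \<and> poly_op (p l) T x i = v i"
    using m by metis
  then show "\<exists>l. \<exists>x\<in>U. poly_op (p l) T x \<in> V"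
    using n1 n2 by (metis less_max_iff_disj)
qed

section \<open>Affine flows in the complex plane\<close>

text \<open>Cauchy's functional equation on the half-line. Additivity settles rational times, and
  continuity the limit of \<open>q k\<close>, which is \<open>t\<close> rounded down to a multiple
  of \<open>1 / Suc k\<close> and so stays non-negative.\<close>

lemma additive_continuous_imp_scaleR:
  fixes f :: "real \<Rightarrow> 'a::real_normed_vector"
  assumes cont: "continuous_on {0..} f"
    and add: "\<And>s t. s \<ge> 0 \<Longrightarrow> t \<ge> 0 \<Longrightarrow> f (s + t) = f s + f t"
    and t: "t \<ge> 0"
  shows "f t = t *\<^sub>R f 1"
proof -
  have f0: "f 0 = 0" using add[of 0 0] by simp
  have mult: "f (real n * s) = real n *\<^sub>R f s" if "s \<ge> 0" for n s
  proof (induction n)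
    case 0
    then show ?case by (simp add: f0)
  next
    case (Suc n)
    have "f (s + real n * s) = f s + f (real n * s)" using that by (intro add) auto
    then show ?case using Suc by (simp add: algebra_simps)
  qed
  define q where "q k = real (nat \<lfloor>real (Suc k) * t\<rfloor>) / real (Suc k)" for k
  have fq: "f (q k) = q k *\<^sub>R f 1" for k
  proof -
    let ?m = "real (nat \<lfloor>real (Suc k) * t\<rfloor>)"
    have "real (Suc k) *\<^sub>R f (q k) = f (real (Suc k) * q k)"
      by (rule mult[symmetric]) (simp add: q_def)
    also have "\<dots> = f (?m * 1)" by (simp add: q_def)
    also have "\<dots> = ?m *\<^sub>R f 1" by (rule mult) simp
    finally have "(1 / real (Suc k)) *\<^sub>R (real (Suc k) *\<^sub>R f (q k)) = (1 / real (Suc k)) *\<^sub>R (?m *\<^sub>R f 1)"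
      by simp
    then show ?thesis by (simp add: q_def)
  qed
  have "\<bar>q k - t\<bar> \<le> 1 / real (Suc k)" for k
  proof -
    have "real (Suc k) * t - 1 \<le> of_int \<lfloor>real (Suc k) * t\<rfloor>" "of_int \<lfloor>real (Suc k) * t\<rfloor> \<le> real (Suc k) * t"
      by linarith+
    moreover have "real (nat \<lfloor>real (Suc k) * t\<rfloor>) = of_int \<lfloor>real (Suc k) * t\<rfloor>"
      using t by (simp add: of_nat_nat)
    ultimately have "\<bar>real (nat \<lfloor>real (Suc k) * t\<rfloor>) - real (Suc k) * t\<bar> \<le> 1"
      by linarith
    moreover have "q k - t = (real (nat \<lfloor>real (Suc k) * t\<rfloor>) - real (Suc k) * t) / real (Suc k)"
      by (simp add: q_def diff_divide_distrib del: of_nat_Suc)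
    ultimately show ?thesis by (simp add: abs_divide divide_right_mono del: of_nat_Suc)
  qed
  then have "\<forall>\<^sub>F k in sequentially. norm (q k - t) \<le> 1 / real (Suc k)"
    by (intro always_eventually allI) (simp only: real_norm_def)
  then have "(\<lambda>k. q k - t) \<longlonglongrightarrow> 0"
    by (rule Lim_null_comparison[OF _ LIMSEQ_Suc[OF lim_1_over_n]])
  then have qt: "q \<longlonglongrightarrow> t" by (rule LIM_zero_cancel)
  have "(\<lambda>k. f (q k)) \<longlonglongrightarrow> f t"
    by (rule continuous_on_tendsto_compose[OF cont qt]) (simp_all add: t q_def)
  moreover have "(\<lambda>k. f (q k)) \<longlonglongrightarrow> t *\<^sub>R f 1"
    unfolding fq by (intro tendsto_intros qt)
  ultimately show ?thesis by (rule LIMSEQ_unique)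
qed

text \<open>Since \<open>a t\<close> is the \<open>n\<close>-th power of \<open>a (t / n)\<close>, a
  zero at \<open>t\<close> would propagate to all \<open>t / n\<close>, where the values tend to
  1.\<close>

lemma multiplicative_continuous_nonzero:
  fixes a :: "real \<Rightarrow> 'a::real_normed_field"
  assumes cont: "continuous_on {0..} a" and a0: "a 0 = 1"
    and mult: "\<And>s t. s \<ge> 0 \<Longrightarrow> t \<ge> 0 \<Longrightarrow> a (s + t) = a s * a t"
    and t: "t \<ge> 0"
  shows "a t \<noteq> 0"
proof -
  have pow: "a (real n * s) = a s ^ n" if "s \<ge> 0" for n s
  proof (induction n)
    case 0
    then show ?case by (simp add: a0)
  next
    case (Suc n)
    have "a (s + real n * s) = a s * a (real n * s)" using that by (intro mult) auto
    then show ?case using Suc by (simp add: algebra_simps)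
  qed
  have lim: "(\<lambda>n. t / real (Suc n)) \<longlonglongrightarrow> 0"
    using tendsto_mult_right_zero[OF LIMSEQ_Suc[OF lim_1_over_n], of t] by simp
  have "(\<lambda>n. a (t / real (Suc n))) \<longlonglongrightarrow> a 0"
    using cont lim t by (intro continuous_on_tendsto_compose[of "{0..}" a]) auto
  then have "\<forall>\<^sub>F n in sequentially. a (t / real (Suc n)) \<noteq> 0"
    using a0 by (intro tendsto_imp_eventually_ne[where c = "a 0"]) auto
  then obtain n where "a (t / real (Suc n)) \<noteq> 0" by (auto simp: eventually_sequentially)
  then have "a (real (Suc n) * (t / real (Suc n))) \<noteq> 0" using t by (subst pow) auto
  then show ?thesis by simp
qed

text \<open>Either the affine flow is a translation and the orbit is a ray, or it has a fixed point; then
  the orbit is bounded, or it is closed and meets each circle around the fixed point at most once.\<close>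

lemma affine_orbit_not_dense_in_line:
  fixes r \<alpha> \<beta> :: "real \<Rightarrow> complex"
  assumes r: "continuous_on {0..} r" and \<alpha>: "continuous_on {0..} \<alpha>"
    and \<alpha>0: "\<alpha> 0 = 1" and mult: "\<And>s t. s \<ge> 0 \<Longrightarrow> t \<ge> 0 \<Longrightarrow> \<alpha> (s + t) = \<alpha> s * \<alpha> t"
    and flow: "\<And>s t. s \<ge> 0 \<Longrightarrow> t \<ge> 0 \<Longrightarrow> r (s + t) = \<alpha> t * r s + \<beta> t"
    and v: "v \<noteq> 0"
    and dense: "\<And>u::real. r 0 + u * v \<in> closure (r ` {0..})"
  shows False
proof (cases "\<forall>t\<ge>0. \<alpha> t = 1")
  case True
  have \<beta>: "\<beta> t = r t - r 0" if "t \<ge> 0" for t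
    using flow[of 0 t] True that by simp
  have lin: "r t - r 0 = t *\<^sub>R (r 1 - r 0)" if "t \<ge> 0" for t
  proof (rule additive_continuous_imp_scaleR[OF _ _ that])
    show "continuous_on {0..} (\<lambda>t. r t - r 0)" by (intro continuous_intros r)
    show "r (s + t) - r 0 = (r s - r 0) + (r t - r 0)" if "s \<ge> 0" "t \<ge> 0" for s t
      using flow[of s t] \<beta>[of t] True that by simp
  qed
  define w where "w = r 1 - r 0"
  have rt: "r t = r 0 + t *\<^sub>R w" if "t \<ge> 0" for t
    unfolding w_def lin[OF that, symmetric] by simp
  \<comment> \<open>The equality case of the Cauchy-Schwarz inequality: for
    \<open>w \<noteq> 0\<close> this is the ray from \<open>r 0\<close> in direction
    \<open>w\<close>, written as a closed condition.\<close>
  let ?C = "{p. complex_of_real (cmod (p - r 0) * cmod w) = (p - r 0) * cnj w}"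
  have "closed ?C" by (intro closed_Collect_eq continuous_intros)
  moreover have "r ` {0..} \<subseteq> ?C"
  proof (intro image_subsetI CollectI)
    fix t :: real assume "t \<in> {0..}"
    then have "t \<ge> 0" by simp
    then have d: "r t - r 0 = complex_of_real t * w"
      by (subst rt) (simp_all add: scaleR_conv_of_real)
    then have "cmod (r t - r 0) * cmod w = t * (cmod w)\<^sup>2"
      using \<open>t \<ge> 0\<close> by (simp add: norm_mult power2_eq_square)
    moreover have "(r t - r 0) * cnj w = complex_of_real (t * (cmod w)\<^sup>2)"
      using complex_norm_square[of w] by (simp add: d)
    ultimately show "complex_of_real (cmod (r t - r 0) * cmod w) = (r t - r 0) * cnj w" by metis
  qed
  ultimately have sub: "closure (r ` {0..}) \<subseteq> ?C" by (intro closure_minimal)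
  \<comment> \<open>A ray cannot contain both \<open>r 0 + v\<close> and \<open>r 0 - v\<close>, so
    \<open>w = 0\<close> and the orbit is a single point.\<close>
  have "complex_of_real (cmod v * cmod w) = v * cnj w"
    using subsetD[OF sub dense[of 1]] by simp
  moreover have "complex_of_real (cmod v * cmod w) = - v * cnj w"
    using subsetD[OF sub dense[of "-1"]] by simp
  ultimately have "v * cnj w = 0" by simp
  then have "w = 0" using v by simp
  then have "r t = r 0" if "t \<ge> 0" for t using rt[OF that] by simp
  then have "r ` {0..} \<subseteq> {r 0}" by blast
  then have "closure (r ` {0..}) \<subseteq> {r 0}" by (intro closure_minimal) auto
  then show False using dense[of 1] v by auto
next
  case False
  then obtain \<tau> where \<tau>: "\<tau> \<ge> 0" "\<alpha> \<tau> \<noteq> 1" by blast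
  \<comment> \<open>The fixed point of the map at time \<open>\<tau>\<close>; it turns out to be the
    centre for all times.\<close>
  define p where "p = \<beta> \<tau> / (1 - \<alpha> \<tau>)"
  have p: "\<beta> \<tau> = (1 - \<alpha> \<tau>) * p" using \<tau> by (simp add: p_def)
  have fixed: "r t - p = \<alpha> t * (r 0 - p)" if t: "t \<ge> 0" for t
  proof -
    \<comment> \<open>The third premise equates the two expressions for
      \<open>r (t + \<tau>)\<close>, the last step being taken by time \<open>\<tau>\<close> or by
      time \<open>t\<close>; it remains to cancel \<open>\<alpha> \<tau> - 1\<close>.\<close>
    have alg: "(a - 1) * (y - p) = (a - 1) * (b * (x - p))"
      if "z = a * x + (1 - a) * p" "y = b * x + d" "a * y + (1 - a) * p = b * z + d"
      for a b d x y z p :: complex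
      using that by algebra
    have "(\<alpha> \<tau> - 1) * (r t - p) = (\<alpha> \<tau> - 1) * (\<alpha> t * (r 0 - p))"
    proof (rule alg)
      show "r \<tau> = \<alpha> \<tau> * r 0 + (1 - \<alpha> \<tau>) * p"
        using flow[of 0 \<tau>] \<tau> by (simp only: p[symmetric] add_0 order_refl)
      show "r t = \<alpha> t * r 0 + \<beta> t" using flow[of 0 t] t by simp
      show "\<alpha> \<tau> * r t + (1 - \<alpha> \<tau>) * p = \<alpha> t * r \<tau> + \<beta> t"
        using flow[of \<tau> t] flow[of t \<tau>] t \<tau>(1) by (simp only: p[symmetric] add.commute)
    qed
    then show ?thesis using \<tau> by simp
  qed
  have nz: "\<alpha> t \<noteq> 0" if "t \<ge> 0" for t
    using multiplicative_continuous_nonzero[OF \<alpha> \<alpha>0 mult that] by blast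
  define l where "l = ln (cmod (\<alpha> 1))"
  have ln_lin: "ln (cmod (\<alpha> t)) = t *\<^sub>R ln (cmod (\<alpha> 1))" if "t \<ge> 0" for t
  proof (rule additive_continuous_imp_scaleR[OF _ _ that])
    show "continuous_on {0..} (\<lambda>t. ln (cmod (\<alpha> t)))"
      using nz by (intro continuous_intros \<alpha>) auto
    show "ln (cmod (\<alpha> (s + t))) = ln (cmod (\<alpha> s)) + ln (cmod (\<alpha> t))"
      if "s \<ge> 0" "t \<ge> 0" for s t
      unfolding mult[OF that] norm_mult using nz that by (subst ln_mult) auto
  qed
  have ln\<alpha>: "ln (cmod (\<alpha> t)) = t * l" if "t \<ge> 0" for t
    using ln_lin[OF that] by (simp add: l_def)
  have norm\<alpha>: "cmod (\<alpha> t) = exp (t * l)" if "t \<ge> 0" for t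
    unfolding ln\<alpha>[OF that, symmetric] using nz[OF that] by simp
  define d where "d = cmod (r 0 - p)"
  have normr: "cmod (r t - p) = exp (t * l) * d" if "t \<ge> 0" for t
    unfolding fixed[OF that] d_def using norm\<alpha>[OF that] by (simp add: norm_mult)
  show False
  proof (cases "l \<le> 0 \<or> d = 0")
    case True
    have "r ` {0..} \<subseteq> cball p d"
    proof (intro image_subsetI)
      fix t :: real assume "t \<in> {0..}"
      then have "t \<ge> 0" by simp
      have "exp (t * l) * d \<le> 1 * d"
      proof (cases "d = 0")
        case False
        then have "exp (t * l) \<le> 1"
          using True \<open>t \<ge> 0\<close> by (simp add: mult_nonneg_nonpos)
        then show ?thesis by (rule mult_right_mono) (simp add: d_def)
      qed simp
      then show "r t \<in> cball p d"
        using normr[OF \<open>t \<ge> 0\<close>] by (simp add: dist_norm norm_minus_commute)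
    qed
    then have sub: "closure (r ` {0..}) \<subseteq> cball p d" by (intro closure_minimal) auto
    \<comment> \<open>Makes the modulus of \<open>u * v\<close> equal to \<open>2 * d + 1\<close>,
      more than the diameter of the ball.\<close>
    define u where "u = (2 * d + 1) / cmod v"
    have "d \<ge> 0" by (simp add: d_def)
    have "cmod (r 0 + u * v - p) \<le> d"
      using subsetD[OF sub dense[of u]] by (simp add: dist_norm norm_minus_commute)
    then have "cmod (u * v) \<le> d + d"
      using norm_triangle_ineq4[of "r 0 + u * v - p" "r 0 - p"] by (simp add: d_def algebra_simps)
    moreover have "cmod (u * v) = 2 * d + 1"
      unfolding norm_mult norm_of_real using v \<open>d \<ge> 0\<close> by (simp add: u_def)
    ultimately show False by simp
  next
    case False
    then have l: "l > 0" and d: "d > 0" by (auto simp: d_def)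
    \<comment> \<open>The distance to \<open>p\<close> is \<open>exp (t * l) * d\<close>, so the
      time is a continuous function of the point; for a convergent sequence on the orbit the times
      converge as well.\<close>
    have on_curve: "q = r (ln (cmod (q - p) / d) / l)" if q: "q \<in> closure (r ` {0..})" for q
    proof -
      obtain s where s: "\<And>n. s n \<in> r ` {0..}" "s \<longlonglongrightarrow> q"
        using q unfolding closure_sequential by blast
      then have "\<forall>n. \<exists>t\<ge>0. s n = r t" by auto
      then obtain t where t: "\<And>n. t n \<ge> 0" "\<And>n. s n = r (t n)" by metis
      let ?L = "\<lambda>z. ln (cmod (z - p) / d) / l"
      have tn: "t n = ?L (s n)" for n
        using normr[OF t(1)] t(2) l d by simp
      have "cmod (s n - p) \<ge> d" for n
        using normr[OF t(1)] t l d by (simp add: mult_le_cancel_right1)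
      moreover have "(\<lambda>n. cmod (s n - p)) \<longlonglongrightarrow> cmod (q - p)" by (intro tendsto_intros s)
      ultimately have "cmod (q - p) \<ge> d" by (intro LIMSEQ_le_const) auto
      then have "(\<lambda>n. ?L (s n)) \<longlonglongrightarrow> ?L q"
        using d l by (intro tendsto_intros s) auto
      then have lim: "t \<longlonglongrightarrow> ?L q" by (simp add: tn[symmetric])
      then have "?L q \<ge> 0" using t(1) by (intro LIMSEQ_le_const) auto
      then have "(\<lambda>n. r (t n)) \<longlonglongrightarrow> r (?L q)"
        using r lim t(1) by (intro continuous_on_tendsto_compose[of "{0..}" r]) auto
      then show ?thesis using s(2) LIMSEQ_unique by (simp add: t(2)[symmetric]) blast
    qed
    \<comment> \<open>The parameter of the foot of the perpendicular from \<open>p\<close> to the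
      line; the points at parameters \<open>u + 1\<close> and \<open>u - 1\<close> are then
      equidistant from \<open>p\<close>.\<close>
    define u where "u = Re ((p - r 0) * cnj v) / (cmod v)\<^sup>2"
    define q where "q s = r 0 + complex_of_real (u + s) * v" for s :: real
    have qs: "q s \<in> closure (r ` {0..})" for s
      unfolding q_def by (rule dense)
    have "(cmod (q s - p))\<^sup>2 = (cmod (q 0 - p))\<^sup>2 + s\<^sup>2 * (cmod v)\<^sup>2" for s
    proof -
      have "(q 0 - p) * cnj v = - ((p - r 0) * cnj v) + complex_of_real (u * (cmod v)\<^sup>2)"
        using complex_norm_square[of v] by (simp add: q_def algebra_simps)
      then have "Re ((q 0 - p) * cnj v) = - Re ((p - r 0) * cnj v) + u * (cmod v)\<^sup>2"
        by (simp only: plus_complex.simps uminus_complex.simps Re_complex_of_real)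
      also have "\<dots> = 0" using v by (simp add: u_def)
      finally have "Re ((q 0 - p) * cnj v) = 0" .
      then have orth: "Re (q 0 - p) * Re v + Im (q 0 - p) * Im v = 0" by simp
      have "q s - p = (q 0 - p) + s * v" by (simp add: q_def algebra_simps)
      then have "(cmod (q s - p))\<^sup>2 = (Re (q 0 - p) + s * Re v)\<^sup>2 + (Im (q 0 - p) + s * Im v)\<^sup>2"
        by (simp add: cmod_power2 algebra_simps)
      also have "\<dots> = (cmod (q 0 - p))\<^sup>2 + s\<^sup>2 * (cmod v)\<^sup>2 +
          2 * s * (Re (q 0 - p) * Re v + Im (q 0 - p) * Im v)"
        unfolding cmod_power2 by (simp add: power2_eq_square algebra_simps)
      finally show ?thesis unfolding orth by simp
    qed
    from this[of 1] this[of "-1"] have "(cmod (q 1 - p))\<^sup>2 = (cmod (q (-1) - p))\<^sup>2" by simp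
    then have "cmod (q 1 - p) = cmod (q (-1) - p)" by (rule power2_eq_imp_eq) auto
    then have "q 1 = q (-1)" using on_curve[OF qs] by metis
    then show False using v by (simp add: q_def)
  qed
qed

section \<open>Strongly continuous semigroups\<close>

text \<open>The analogue of \<open>dual_op\<close> for complex-valued functionals, also on real
  \<open>omega\<close>.\<close>

definition pullback :: "('a \<Rightarrow> 'a) \<Rightarrow> ('a \<Rightarrow> complex) \<Rightarrow> ('a \<Rightarrow> complex)" where
  "pullback T f = (\<lambda>x. f (T x))"

lemma linear_pullback: "Vector_Spaces.linear fscale fscale (pullback T)"
  by (auto simp: omega_linear_iff pullback_def fscale_def plus_fun_def)

lemma pullback_simps:
  "pullback T 0 = 0" "pullback T (f + g) = pullback T f + pullback T g"
  "pullback T (f - g) = pullback T f - pullback T g"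
  "pullback T (fscale c f) = fscale c (pullback T f)"
  by (auto simp: pullback_def fscale_def fun_eq_iff)

lemma pullback_span:
  assumes "\<And>g. g \<in> G \<Longrightarrow> pullback T g \<in> fun_space.span H" "f \<in> fun_space.span G"
  shows "pullback T f \<in> fun_space.span H"
  using assms(2)
proof (induction rule: fun_space.span_induct_alt)
  case base
  show ?case unfolding pullback_simps by (rule fun_space.span_zero)
next
  case (step c x y)
  show ?case unfolding pullback_simps
    by (intro fun_space.span_add fun_space.span_scale assms(1)[OF step(1)] step(2))
qed

text \<open>Instantiated with the identity of \<open>complex\<close> and with
  \<open>complex_of_real\<close>, so that one argument about complex-valued functionals serves both
  fields.\<close>

locale scalar_embedding =
  fixes \<iota> :: "'k::{real_normed_field, polish_space} \<Rightarrow> complex"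
  assumes \<iota>_add: "\<iota> (x + y) = \<iota> x + \<iota> y" and \<iota>_mult: "\<iota> (x * y) = \<iota> x * \<iota> y"
    and \<iota>_of_real: "\<iota> (of_real r) = of_real r" and norm_\<iota>: "cmod (\<iota> x) = norm x"
begin

lemma \<iota>_simps [simp]: "\<iota> 0 = 0" "\<iota> 1 = 1" "\<iota> x = 0 \<longleftrightarrow> x = 0"
  using \<iota>_of_real[of 0] \<iota>_of_real[of 1] norm_\<iota>[of x] by auto

lemma \<iota>_diff: "\<iota> (x - y) = \<iota> x - \<iota> y"
  using \<iota>_add[of "x - y" y] by simp

lemma continuous_on_\<iota> [continuous_intros]: "continuous_on A f \<Longrightarrow> continuous_on A (\<lambda>x. \<iota> (f x))"
proof -
  have "continuous_on UNIV \<iota>"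
    unfolding continuous_on_iff dist_norm \<iota>_diff[symmetric] norm_\<iota> by blast
  then show "continuous_on A f \<Longrightarrow> continuous_on A (\<lambda>x. \<iota> (f x))"
    by (rule continuous_on_compose2) auto
qed

text \<open>The complexified dual: scalars of \<open>omega\<close> pass through
  \<open>\<iota>\<close>, while the functionals themselves form a complex vector space.\<close>

definition functional :: "('k omega \<Rightarrow> complex) \<Rightarrow> bool" where
  "functional f \<longleftrightarrow> (\<forall>x y. f (x + y) = f x + f y) \<and> (\<forall>c x. f (fscale c x) = \<iota> c * f x) \<and>
     continuous_on UNIV f"

lemma functionalD:
  assumes "functional f"
  shows "f (x + y) = f x + f y" "f (fscale c x) = \<iota> c * f x" "continuous_on UNIV f" "f 0 = 0"
proof -
  show "f (x + y) = f x + f y" "f (fscale c x) = \<iota> c * f x" "continuous_on UNIV f"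
    using assms by (auto simp: functional_def)
  have "f (fscale 0 0) = \<iota> 0 * f 0" using assms unfolding functional_def by blast
  then show "f 0 = 0" by simp
qed

lemma functional_sum:
  assumes "functional f"
  shows "f (sum g A) = (\<Sum>i\<in>A. f (g i))"
  by (induction A rule: infinite_finite_induct)
    (simp_all only: sum.infinite sum.empty sum.insert functionalD[OF assms] if_False simp_thms)

lemma functional_subspace: "fun_space.subspace {f. functional f}"
  by (rule fun_space.subspaceI)
    (auto simp: functional_def fscale_def algebra_simps plus_fun_def zero_fun_def
      intro!: continuous_intros)

lemma functional_pullback:
  assumes "functional f" "T \<in> operators"
  shows "functional (pullback T f)"
proof -
  have "continuous_on UNIV (\<lambda>x. f (T x))"
    using assms continuous_on_compose2[of UNIV f UNIV T] by (simp add: functional_def operators_def)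
  then show ?thesis
    using assms by (simp add: functional_def pullback_def operators_def omega_linear_iff)
qed

definition coord :: "nat \<Rightarrow> 'k omega \<Rightarrow> complex" where
  "coord i = (\<lambda>x. \<iota> (x i))"

lemma functional_coord: "functional (coord i)"
  by (auto simp: functional_def coord_def \<iota>_add \<iota>_mult fscale_def
      intro!: continuous_intros continuous_on_product_coordinates)

definition unit :: "nat \<Rightarrow> 'k omega" where
  "unit i = (\<lambda>j. if j = i then 1 else 0)"

lemma coord_unit: "coord i (unit j) = (if i = j then 1 else 0)"
  by (simp add: coord_def unit_def)

lemma inj_coord: "inj coord"
  by (rule injI) (metis coord_unit zero_neq_one)

lemma independent_coord:
  assumes "finite I"
  shows "fun_space.independent (coord ` I)"
proof
  assume "fun_space.dependent (coord ` I)"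
  then obtain u i where i: "i \<in> I" "u (coord i) \<noteq> 0"
    and "(\<Sum>v\<in>coord ` I. fscale (u v) v) = 0"
    using fun_space.dependent_finite[of "coord ` I"] assms by auto
  then have "(\<Sum>i\<in>I. fscale (u (coord i)) (coord i)) = 0"
    by (simp add: sum.reindex inj_on_subset[OF inj_coord])
  then have "(\<Sum>j\<in>I. fscale (u (coord j)) (coord j)) (unit i) = 0" by simp
  then have "(\<Sum>j\<in>I. if j = i then u (coord j) else 0) = 0"
    by (simp add: sum_fun_apply fscale_def coord_unit if_distrib[of "\<lambda>x. _ * x"] cong: if_cong)
  then show False using i assms by simp
qed

text \<open>Provides functionals outside a small span; applied with three coordinates against one or
  two functionals.\<close>

lemma coord_not_subset_span:
  assumes "finite B" "card B < card I" "finite I"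
  shows "\<not> coord ` I \<subseteq> fun_space.span B"
proof
  assume "coord ` I \<subseteq> fun_space.span B"
  then have "card (coord ` I) \<le> card B"
    using fun_space.independent_span_bound[OF assms(1) independent_coord[OF assms(3)]] by blast
  then show False using assms(2) by (simp add: card_image inj_on_subset[OF inj_coord])
qed

text \<open>Subtracting from \<open>x\<close> its truncation to the first \<open>m\<close>
  coordinates leaves a vector on which \<open>f\<close> vanishes, so the values on unit vectors
  determine \<open>f\<close>.\<close>

lemma in_span_coord:
  assumes f: "functional f" and vanish: "\<And>x. (\<forall>i<m. x i = 0) \<Longrightarrow> f x = 0"
  shows "f \<in> fun_space.span (coord ` {..<m})"
proof -
  have "f = (\<Sum>i<m. fscale (f (unit i)) (coord i))"
  proof
    fix x :: "'k omega"
    let ?y = "\<Sum>i<m. fscale (x i) (unit i)"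
    have y: "?y j = (if j < m then x j else 0)" for j
    proof -
      have "?y j = (\<Sum>i<m. if i = j then x i else 0)"
        unfolding sum_fun_apply by (intro sum.cong) (auto simp: fscale_def unit_def)
      then show ?thesis by simp
    qed
    have fy: "f ?y = (\<Sum>i<m. \<iota> (x i) * f (unit i))"
      unfolding functional_sum[OF f] functionalD(2)[OF f] ..
    have "f (x + fscale (- 1) ?y) = 0"
      by (rule vanish) (simp add: fscale_def[of "- 1" ?y] y)
    then have "f x + \<iota> (- 1) * f ?y = 0" by (simp only: functionalD(1,2)[OF f])
    moreover have "\<iota> (- 1) = - 1" using \<iota>_of_real[of "- 1"] by simp
    ultimately have eq: "f x = f ?y" by simp
    show "f x = (\<Sum>i<m. fscale (f (unit i)) (coord i)) x"
      unfolding eq fy by (simp add: sum_fun_apply fscale_def coord_def mult.commute)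
  qed
  then show ?thesis
    by (metis (no_types, lifting) fun_space.span_base fun_space.span_scale fun_space.span_sum imageI)
qed

end

section \<open>Finite-dimensional invariant spaces of functionals\<close>

locale strongly_continuous_semigroup = scalar_embedding \<iota>
  for \<iota> :: "'k::{real_normed_field, polish_space} \<Rightarrow> complex" +
  fixes S :: "real \<Rightarrow> 'k omega \<Rightarrow> 'k omega"
  assumes semigroup: "operator_semigroup S" and strong: "strongly_continuous S"
begin

lemma S_operator: "t \<ge> 0 \<Longrightarrow> S t \<in> operators"
  and S_0: "S 0 x = x"
  and S_add: "s \<ge> 0 \<Longrightarrow> t \<ge> 0 \<Longrightarrow> S (s + t) x = S t (S s x)"
  using semigroup by (auto simp: operator_semigroup_def)

lemma S_commute: "s \<ge> 0 \<Longrightarrow> t \<ge> 0 \<Longrightarrow> S s (S t x) = S t (S s x)"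
  using S_add[of s t x] S_add[of t s x] by (simp add: add.commute)

lemma S_linear:
  assumes "t \<ge> 0"
  shows "S t (x + y) = S t x + S t y" "S t (fscale c x) = fscale c (S t x)"
  using S_operator[OF assms] by (auto simp: operators_def omega_linear_iff)

lemma continuous_on_orbit:
  assumes "functional f"
  shows "continuous_on {0..} (\<lambda>t. f (S t x))"
  using functionalD(3)[OF assms] strong unfolding strongly_continuous_def
  by (intro continuous_on_compose2[of UNIV f "{0..}" "\<lambda>t. S t x"]) auto

lemma continuous_on_operator_coord:
  assumes "t \<ge> 0"
  shows "continuous_on UNIV (\<lambda>x. S t x i)"
proof -
  have "continuous_on UNIV (S t)" using S_operator[OF assms] by (simp add: operators_def)
  then show ?thesis by (rule continuous_on_product_then_coordinatewise)
qed

text \<open>By Baire's theorem the first \<open>n\<close> coordinates of \<open>S\<^sub>t\<close> are uniformly bounded on a cylinder, and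
  a linear functional that is bounded on a translate of a subspace vanishes on that subspace.\<close>

lemma uniform_finite_dependence:
  "\<exists>m. \<forall>t x i. 0 \<le> t \<longrightarrow> t \<le> 1 \<longrightarrow> (\<forall>j<m. x j = 0) \<longrightarrow> i < n \<longrightarrow> S t x i = 0"
proof -
  define B where "B k = {x. \<forall>t\<in>{0..1}. \<forall>i\<in>{..<n}. norm (S t x i) \<le> real k}" for k :: nat
  have closed: "closed (B k)" for k
  proof -
    have "closed {x. norm (S t x i) \<le> real k}" if "t \<in> {0..1}" for t i
      using that by (intro closed_Collect_le continuous_intros continuous_on_operator_coord) auto
    then have "closed (\<Inter>t\<in>{0..1}. \<Inter>i\<in>{..<n}. {x. norm (S t x i) \<le> real k})" by blast
    moreover have "(\<Inter>t\<in>{0..1}. \<Inter>i\<in>{..<n}. {x. norm (S t x i) \<le> real k}) = B k"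
      by (auto simp: B_def)
    ultimately show ?thesis by simp
  qed
  \<comment> \<open>Pointwise boundedness: by strong continuity each coordinate of an orbit is
    bounded on the compact time interval.\<close>
  have cover: "\<exists>k. x \<in> B k" for x
  proof -
    have "\<exists>b. \<forall>t\<in>{0..1}. norm (S t x i) \<le> b" for i
    proof -
      have "continuous_on {0..} (\<lambda>t. S t x)"
        using strong by (simp add: strongly_continuous_def)
      then have "continuous_on {0..1} (\<lambda>t. S t x)" by (rule continuous_on_subset) auto
      then have "continuous_on {0..1} (\<lambda>t. S t x i)"
        by (rule continuous_on_product_then_coordinatewise)
      then have "continuous_on {0..1} (\<lambda>t. norm (S t x i))" by (rule continuous_on_norm)
      then have "bounded ((\<lambda>t. norm (S t x i)) ` {0..1})"
        by (intro compact_imp_bounded compact_continuous_image) auto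
      then show ?thesis unfolding bounded_iff by fastforce
    qed
    then obtain b where b: "\<And>i t. t \<in> {0..1} \<Longrightarrow> norm (S t x i) \<le> b i" by metis
    obtain k :: nat where k: "(\<Sum>i<n. \<bar>b i\<bar>) \<le> real k" using real_arch_simple by blast
    have "norm (S t x i) \<le> real k" if "t \<in> {0..1}" "i < n" for t i
    proof -
      have "norm (S t x i) \<le> \<bar>b i\<bar>" using b[OF that(1), of i] by linarith
      also have "\<dots> \<le> (\<Sum>i<n. \<bar>b i\<bar>)" using that(2) by (intro member_le_sum) auto
      finally show ?thesis using k by simp
    qed
    then show ?thesis unfolding B_def by blast
  qed
  have "\<exists>k. interior (B k) \<noteq> {}"
  proof (rule ccontr)
    assume no: "\<not> ?thesis"
    have "euclidean interior_of (\<Union>(range B)) = {}"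
    proof (rule Baire_category_alt)
      show "completely_metrizable_space (euclidean :: 'k omega topology) \<or>
        locally_compact_space (euclidean :: 'k omega topology) \<and>
        regular_space (euclidean :: 'k omega topology)"
        by (simp add: completely_metrizable_space_euclidean)
      show "countable (range B)" by simp
      show "closedin euclidean T \<and> euclidean interior_of T = {}" if "T \<in> range B" for T
        using that closed no by auto
    qed
    moreover have "\<Union>(range B) = UNIV" using cover by auto
    ultimately show False by simp
  qed
  then obtain k x0 where "x0 \<in> interior (B k)" by blast
  then obtain m where m: "\<And>y. (\<forall>i<m. y i = x0 i) \<Longrightarrow> y \<in> B k"
    using open_contains_cylinder[OF open_interior] interior_subset by (metis subsetD)
  have "S t x i = 0" if t: "0 \<le> t" "t \<le> 1" and x: "\<forall>j<m. x j = 0" and i: "i < n" for t x i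
  proof (rule ccontr)
    assume "S t x i \<noteq> 0"
    \<comment> \<open>Both \<open>x0\<close> and every \<open>x0 + N x\<close> belong to the
      cylinder, hence to \<open>B k\<close>, so \<open>N * norm (S t x i)\<close> is at most
      \<open>2 * k\<close>; this \<open>N\<close> violates that.\<close>
    then obtain N :: nat where N: "2 * real k < real N * norm (S t x i)"
      using reals_Archimedean3[of "norm (S t x i)"] by auto
    have "x0 \<in> B k" by (rule m) simp
    then have "norm (S t x0 i) \<le> real k" using t i by (auto simp: B_def)
    moreover have "x0 + fscale (of_nat N) x \<in> B k" by (rule m) (simp add: fscale_def x)
    then have "norm (S t (x0 + fscale (of_nat N) x) i) \<le> real k" using t i by (auto simp: B_def)
    then have "norm (S t x0 i + of_nat N * S t x i) \<le> real k"
      unfolding S_linear[OF t(1)] by (simp add: fscale_def)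
    moreover have "norm (of_nat N * S t x i) \<le> norm (S t x0 i + of_nat N * S t x i) + norm (S t x0 i)"
      by (metis add_diff_cancel_left' norm_triangle_ineq4)
    ultimately show False using N by (simp add: norm_mult)
  qed
  then show ?thesis by blast
qed

definition generators :: "nat \<Rightarrow> real \<Rightarrow> ('k omega \<Rightarrow> complex) set" where
  "generators n \<tau> = {pullback (S t) (coord i) |t i. 0 \<le> t \<and> t \<le> \<tau> \<and> i < n}"

text \<open>The spans of the initial orbit segments decrease as the time interval shrinks, so their
  dimension is eventually constant; from then on the span is invariant.\<close>

lemma ex_invariant_span:
  "\<exists>\<tau>>0. \<exists>m. fun_space.span (generators n \<tau>) \<subseteq> fun_space.span (coord ` {..<m}) \<and>
     (\<forall>t\<ge>0. \<forall>f\<in>fun_space.span (generators n \<tau>). pullback (S t) f \<in> fun_space.span (generators n \<tau>))"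
proof -
  let ?E = "\<lambda>\<tau>. fun_space.span (generators n \<tau>)"
  obtain m where m: "\<And>t x i. 0 \<le> t \<Longrightarrow> t \<le> 1 \<Longrightarrow> \<forall>j<m. x j = 0 \<Longrightarrow> i < n \<Longrightarrow> S t x i = 0"
    using uniform_finite_dependence by blast
  have "generators n 1 \<subseteq> fun_space.span (coord ` {..<m})"
  proof
    fix f assume "f \<in> generators n 1"
    then obtain t i where t: "0 \<le> t" "t \<le> 1" "i < n" "f = pullback (S t) (coord i)"
      by (auto simp: generators_def)
    show "f \<in> fun_space.span (coord ` {..<m})"
    proof (rule in_span_coord)
      show "functional f" unfolding t by (intro functional_pullback functional_coord S_operator t)
      show "f x = 0" if "\<forall>i<m. x i = 0" for x
        using m[OF t(1,2) that t(3)] by (simp add: t pullback_def coord_def)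
    qed
  qed
  then have E1: "?E 1 \<subseteq> fun_space.span (coord ` {..<m})"
    by (intro fun_space.span_minimal fun_space.subspace_span)
  have mono: "?E \<tau> \<subseteq> ?E \<tau>'" if "\<tau> \<le> \<tau>'" for \<tau> \<tau>'
    using that by (intro fun_space.span_mono) (force simp: generators_def)
  let ?P = "\<lambda>\<tau>. 0 < \<tau> \<and> \<tau> \<le> 1"
  have P1: "?P (1::real)" by simp
  obtain \<tau> where \<tau>: "?P \<tau>" and min: "\<And>\<sigma>. ?P \<sigma> \<Longrightarrow> fun_space.dim (?E \<tau>) \<le> fun_space.dim (?E \<sigma>)"
    using ex_has_least_nat[of ?P 1 "\<lambda>\<tau>. fun_space.dim (?E \<tau>)", OF P1] by (elim exE conjE) auto
  have E\<tau>: "?E \<tau> \<subseteq> fun_space.span (coord ` {..<m})"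
    using mono[of \<tau> 1] \<tau> E1 by auto
  \<comment> \<open>Minimal dimension stops the descent. Since the generators up to time
    \<open>\<tau> / 2\<close> already span, a shift by at most \<open>\<tau> / 2\<close> leads only
    to generators up to time \<open>\<tau>\<close>.\<close>
  have half: "?E (\<tau> / 2) = ?E \<tau>"
  proof (rule ccontr)
    assume "?E (\<tau> / 2) \<noteq> ?E \<tau>"
    then have "?E (\<tau> / 2) \<subset> ?E \<tau>" using mono[of "\<tau> / 2" \<tau>] \<tau> by auto
    then have "fun_space.dim (?E (\<tau> / 2)) < fun_space.dim (?E \<tau>)"
      using E\<tau> by (intro fun_space.dim_less_of_psubset[where B = "coord ` {..<m}"]
          fun_space.subspace_span) auto
    then show False using min[of "\<tau> / 2"] \<tau> by simp
  qed
  have small: "pullback (S s) f \<in> ?E \<tau>" if s: "0 \<le> s" "s \<le> \<tau> / 2" and f: "f \<in> ?E \<tau>" for s f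
  proof (rule pullback_span)
    show "f \<in> ?E (\<tau> / 2)" using f half by simp
    fix g assume "g \<in> generators n (\<tau> / 2)"
    then obtain t i where t: "0 \<le> t" "t \<le> \<tau> / 2" "i < n" "g = pullback (S t) (coord i)"
      by (auto simp: generators_def)
    have "pullback (S s) g = pullback (S (s + t)) (coord i)"
      by (simp add: t pullback_def S_add[OF s(1) t(1)])
    then have "pullback (S s) g \<in> generators n \<tau>"
      using s t unfolding generators_def by (intro CollectI exI[of _ "s + t"] exI[of _ i]) auto
    then show "pullback (S s) g \<in> ?E \<tau>" by (rule fun_space.span_base)
  qed
  have iter: "pullback (S (real k * s)) f \<in> ?E \<tau>"
    if s: "0 \<le> s" "s \<le> \<tau> / 2" and f: "f \<in> ?E \<tau>" for s f k
  proof (induction k)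
    case 0
    then show ?case using f by (simp add: pullback_def S_0)
  next
    case (Suc k)
    have "pullback (S (s + real k * s)) f = pullback (S s) (pullback (S (real k * s)) f)"
      unfolding pullback_def by (subst S_add) (use s in auto)
    then show ?case using small[OF s Suc] by (simp add: algebra_simps)
  qed
  have "pullback (S t) f \<in> ?E \<tau>" if t: "t \<ge> 0" and f: "f \<in> ?E \<tau>" for t f
  proof -
    \<comment> \<open>Splits \<open>t\<close> into \<open>k\<close> equal steps of length at most
      \<open>\<tau> / 2\<close>.\<close>
    obtain k :: nat where k: "t < real k * (\<tau> / 2)"
      using reals_Archimedean3[of "\<tau> / 2"] \<tau> by auto
    then have k0: "real k > 0" using t \<tau> by (cases "k = 0") auto
    then have "t / real k \<le> \<tau> / 2" using k by (simp add: divide_le_eq mult.commute less_imp_le)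
    then show ?thesis using iter[of "t / real k" f k] t f k0 by simp
  qed
  then show ?thesis using \<tau> E\<tau> by blast
qed

lemma coord_in_generators: "\<tau> \<ge> 0 \<Longrightarrow> i < n \<Longrightarrow> coord i \<in> generators n \<tau>"
  unfolding generators_def
  by (intro CollectI exI[of _ 0] exI[of _ i]) (auto simp: pullback_def S_0)

lemma generators_functional: "f \<in> fun_space.span (generators n \<tau>) \<Longrightarrow> functional f"
  using fun_space.span_minimal[OF _ functional_subspace, of "generators n \<tau>"]
  by (auto simp: generators_def intro!: functional_pullback functional_coord S_operator)

text \<open>Along \<open>y\<close> the \<open>g\<close>-term drops out, so \<open>b\<close> can be
  read off the orbit of \<open>y\<close>, just as \<open>a\<close> is read off the orbit of the
  supercyclic vector \<open>x\<close>. This is the source of their continuity and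
  multiplicativity.\<close>

lemma not_supercyclic:
  assumes super: "supercyclic S"
    and f: "functional f" and g: "functional g" and "g \<noteq> 0"
    and ga: "\<And>t. t \<ge> 0 \<Longrightarrow> pullback (S t) g = fscale (a t) g"
    and fb: "\<And>t. t \<ge> 0 \<Longrightarrow> pullback (S t) f = fscale (b t) f + fscale (c t) g"
    and y: "g y = 0" "f y \<noteq> 0"
  shows False
proof -
  note f' = functionalD[OF f] and g' = functionalD[OF g]
  have gS: "g (S t x) = a t * g x" if "t \<ge> 0" for t x
    using fun_cong[OF ga[OF that], of x] by (simp add: pullback_def fscale_def)
  have fS: "f (S t x) = b t * f x + c t * g x" if "t \<ge> 0" for t x
    using fun_cong[OF fb[OF that], of x] by (simp add: pullback_def fscale_def)
  obtain x where x: "closure {fscale z (S t x) |z t. 0 \<le> t} = UNIV"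
    using super by (auto simp: supercyclic_def)
  let ?O = "{fscale z (S t x) |z t. 0 \<le> t}"
  \<comment> \<open>Otherwise the orbit would stay in the closed kernel of \<open>g\<close>.\<close>
  have gx: "g x \<noteq> 0"
  proof
    assume "g x = 0"
    have "closed {x. g x = 0}" by (intro closed_Collect_eq g'(3) continuous_intros)
    moreover have "?O \<subseteq> {x. g x = 0}" using \<open>g x = 0\<close> by (auto simp: g'(2) gS)
    ultimately have "closure ?O \<subseteq> {x. g x = 0}" by (intro closure_minimal)
    then show False using \<open>g \<noteq> 0\<close> unfolding x by (auto simp: fun_eq_iff)
  qed
  have a: "a t = g (S t x) / g x" if "t \<ge> 0" for t using gS[OF that] gx by simp
  have b: "b t = f (S t y) / f y" if "t \<ge> 0" for t using fS[OF that] y by simp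
  have a0: "a 0 = 1" and b0: "b 0 = 1" using a[of 0] b[of 0] gx y by (auto simp: S_0)
  have a_mult: "a (s + t) = a s * a t" if st: "s \<ge> 0" "t \<ge> 0" for s t
  proof -
    have "g (S (s + t) x) = a (s + t) * g x" by (rule gS) (use st in simp)
    moreover have "g (S (s + t) x) = a t * (a s * g x)"
      unfolding S_add[OF st] gS[OF st(2)] gS[OF st(1)] ..
    ultimately have "a (s + t) * g x = a s * a t * g x" by (simp only: mult_ac)
    then show ?thesis using gx by simp
  qed
  have b_mult: "b (s + t) = b s * b t" if st: "s \<ge> 0" "t \<ge> 0" for s t
  proof -
    have "f (S (s + t) y) = b (s + t) * f y + c (s + t) * g y" by (rule fS) (use st in simp)
    moreover have "f (S (s + t) y) = b t * (b s * f y + c s * g y) + c t * (a s * g y)"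
      unfolding S_add[OF st] fS[OF st(2)] fS[OF st(1)] gS[OF st(1)] ..
    ultimately have "b (s + t) * f y = b s * b t * f y"
      by (simp only: y mult_ac mult_zero_left mult_zero_right add_0_right)
    then show ?thesis using y by simp
  qed
  have "continuous_on {0..} (\<lambda>t. g (S t x) / g x)"
    by (intro continuous_intros continuous_on_orbit g) (simp add: gx)
  then have a_cont: "continuous_on {0..} a" by (rule continuous_on_eq) (simp add: a)
  have "continuous_on {0..} (\<lambda>t. f (S t y) / f y)"
    by (intro continuous_intros continuous_on_orbit f) (simp add: y)
  then have b_cont: "continuous_on {0..} b" by (rule continuous_on_eq) (simp add: b)
  have a_nz: "a t \<noteq> 0" if "t \<ge> 0" for t
    using multiplicative_continuous_nonzero[OF a_cont a0 a_mult that] by blast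
  have gnz: "g (S t x) \<noteq> 0" if "t \<ge> 0" for t using gS[OF that] a_nz[OF that] gx by simp
  define r where "r t = f (S t x) / g (S t x)" for t
  show False
  proof (rule affine_orbit_not_dense_in_line[of r "\<lambda>t. b t / a t" "\<lambda>t. c t / a t" "f y / g x"])
    show "continuous_on {0..} r"
      unfolding r_def using gnz by (intro continuous_intros continuous_on_orbit f g) auto
    show "continuous_on {0..} (\<lambda>t. b t / a t)"
      using a_nz by (intro continuous_intros a_cont b_cont) auto
    show "b 0 / a 0 = 1" by (simp add: a0 b0)
    show "b (s + t) / a (s + t) = b s / a s * (b t / a t)" if "s \<ge> 0" "t \<ge> 0" for s t
      using that by (simp add: a_mult b_mult)
    show "r (s + t) = b t / a t * r s + c t / a t" if st: "s \<ge> 0" "t \<ge> 0" for s t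
      using gnz[OF st(1)] a_nz[OF st(2)]
      by (simp add: r_def S_add[OF st] fS[OF st(2)] gS[OF st(2)] field_simps)
    show "f y / g x \<noteq> 0" using y gx by simp
    show "r 0 + complex_of_real u * (f y / g x) \<in> closure (r ` {0..})" for u :: real
    proof -
      let ?y = "x + fscale (of_real u) y"
      have gy: "g ?y = g x" by (simp add: g' y)
      have val: "f ?y / g ?y = r 0 + complex_of_real u * (f y / g x)"
        unfolding gy by (simp add: f' \<iota>_of_real r_def S_0 add_divide_distrib)
      \<comment> \<open>The approximating points are taken where \<open>g\<close> does not vanish:
        there \<open>f / g\<close> is continuous, and the scalar \<open>w\<close> is non-zero and
        cancels.\<close>
      have "open {z. g z \<noteq> 0}" by (intro open_Collect_neq g'(3) continuous_intros)
      moreover have "?y \<in> {z. g z \<noteq> 0} \<inter> closure ?O" using x gx gy by simp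
      ultimately have "?y \<in> closure ({z. g z \<noteq> 0} \<inter> ?O)"
        using open_Int_closure_subset by (metis (no_types, lifting) subsetD)
      then obtain z where z: "\<And>n. z n \<in> {z. g z \<noteq> 0} \<inter> ?O" "z \<longlonglongrightarrow> ?y"
        unfolding closure_sequential by blast
      have "(\<lambda>n. f (z n)) \<longlonglongrightarrow> f ?y" "(\<lambda>n. g (z n)) \<longlonglongrightarrow> g ?y"
        by (rule continuous_on_tendsto_compose[OF f'(3) z(2)] continuous_on_tendsto_compose[OF g'(3) z(2)];
            simp)+
      then have "(\<lambda>n. f (z n) / g (z n)) \<longlonglongrightarrow> f ?y / g ?y"
        by (rule tendsto_divide) (simp add: gy gx)
      moreover have "f (z n) / g (z n) \<in> r ` {0..}" for n
      proof -
        obtain w t where wt: "z n = fscale w (S t x)" "t \<ge> 0" "g (z n) \<noteq> 0"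
          using z(1)[of n] by auto
        then have "f (z n) / g (z n) = r t"
          unfolding r_def wt(1) f'(2) g'(2) by simp
        then show ?thesis using wt(2) by auto
      qed
      ultimately have "(\<forall>n. f (z n) / g (z n) \<in> r ` {0..}) \<and>
          (\<lambda>n. f (z n) / g (z n)) \<longlonglongrightarrow> r 0 + complex_of_real u * (f y / g x)"
        unfolding val by simp
      then show ?thesis
        unfolding closure_sequential by (rule exI[of _ "\<lambda>n. f (z n) / g (z n)"])
    qed
  qed
qed

end

section \<open>Eigenfunctionals of the semigroup\<close>

context strongly_continuous_semigroup
begin

lemma ex_eigenfunctional_mod:
  assumes W: "fun_space.subspace W" "W \<subset> E" and E: "fun_space.subspace E"
    and B: "finite B" "E \<subseteq> fun_space.span B"
    and inv: "\<And>t f. t \<ge> 0 \<Longrightarrow> f \<in> W \<Longrightarrow> pullback (S t) f \<in> W"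
      "\<And>t f. t \<ge> 0 \<Longrightarrow> f \<in> E \<Longrightarrow> pullback (S t) f \<in> E"
  shows "\<exists>f b. f \<in> E \<and> f \<notin> W \<and> (\<forall>t\<ge>0. pullback (S t) f - fscale (b t) f \<in> W)"
proof -
  have "\<exists>f\<in>E - W. \<forall>A\<in>(\<lambda>t. pullback (S t)) ` {0..}. \<exists>b. A f - fscale b f \<in> W"
  proof (rule common_eigenvector_mod[OF W(1) E W(2) B])
    show "A (A' f) = A' (A f)"
      if "A \<in> (\<lambda>t. pullback (S t)) ` {0..}" "A' \<in> (\<lambda>t. pullback (S t)) ` {0..}" for A A' f
    proof -
      from that(1) obtain s where s: "s \<ge> 0" "A = pullback (S s)" by auto
      from that(2) obtain t where t: "t \<ge> 0" "A' = pullback (S t)" by auto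
      show ?thesis using s t by (simp add: pullback_def S_commute)
    qed
  qed (use inv linear_pullback in auto)
  then obtain f where f: "f \<in> E - W" and "\<forall>t\<in>{0..}. \<exists>b. pullback (S t) f - fscale b f \<in> W"
    by auto
  from bchoice[OF this(2)] f show ?thesis by auto
qed

lemma ex_eigenfunctional:
  assumes E: "fun_space.subspace E" and B: "finite B" "E \<subseteq> fun_space.span B"
    and inv: "\<And>t f. t \<ge> 0 \<Longrightarrow> f \<in> E \<Longrightarrow> pullback (S t) f \<in> E"
    and nz: "h \<in> E" "h \<noteq> 0"
  shows "\<exists>g a. g \<in> E \<and> g \<noteq> 0 \<and> (\<forall>t\<ge>0. pullback (S t) g = fscale (a t) g)"
proof -
  have "\<exists>f b. f \<in> E \<and> f \<notin> {0} \<and> (\<forall>t\<ge>0. pullback (S t) f - fscale (b t) f \<in> {0})"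
  proof (rule ex_eigenfunctional_mod[OF _ _ E B _ inv])
    show "{0} \<subset> E" using fun_space.subspace_0[OF E] nz by auto
  qed (auto simp: pullback_simps fun_space.subspace_single_0)
  then show ?thesis by simp
qed

lemma coord_nonzero: "coord i \<noteq> 0"
  using coord_unit[of i i] by (metis zero_fun_apply zero_neq_one)

text \<open>The hypothesis on ratios says that the range of \<open>g\<close> is one-dimensional over
  the scalar field. An \<open>f\<close> vanishing on the kernel of \<open>g\<close> would then be a
  multiple of \<open>g\<close>, which yields the vector \<open>y\<close> for
  \<open>not_supercyclic\<close>.\<close>

lemma no_scalar_eigenfunctional:
  fixes \<tau> :: real
  defines "E \<equiv> fun_space.span (generators 3 \<tau>)"
  assumes super: "supercyclic S" and \<tau>: "\<tau> > 0" and E: "E \<subseteq> fun_space.span (coord ` {..<m})"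
    and inv: "\<And>t f. t \<ge> 0 \<Longrightarrow> f \<in> E \<Longrightarrow> pullback (S t) f \<in> E"
    and g: "g \<in> E" "g \<noteq> 0" and ga: "\<And>t. t \<ge> 0 \<Longrightarrow> pullback (S t) g = fscale (a t) g"
    and ratio: "\<And>x y. g x \<noteq> 0 \<Longrightarrow> g y / g x \<in> range \<iota>"
  shows False
proof -
  let ?W = "fun_space.span {g}"
  have coord: "coord ` {..<3} \<subseteq> E"
    using coord_in_generators[of \<tau> _ 3] \<tau> unfolding E_def by (auto intro!: fun_space.span_base)
  have W: "?W \<subset> E"
  proof
    show "?W \<subseteq> E" using g(1) unfolding E_def
      by (intro fun_space.span_minimal fun_space.subspace_span) auto
    show "?W \<noteq> E" using coord_not_subset_span[of "{g}" "{..<3}"] coord by auto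
  qed
  have Winv: "pullback (S t) f \<in> ?W" if "t \<ge> 0" "f \<in> ?W" for t f
    using _ that(2)
  proof (rule pullback_span)
    show "pullback (S t) h \<in> ?W" if "h \<in> {g}" for h
      using that ga[OF \<open>t \<ge> 0\<close>] by (auto intro: fun_space.span_scale fun_space.span_base)
  qed
  obtain f b where f: "f \<in> E" "f \<notin> ?W"
    and fb: "\<And>t. t \<ge> 0 \<Longrightarrow> pullback (S t) f - fscale (b t) f \<in> ?W"
    using ex_eigenfunctional_mod[OF fun_space.subspace_span W _ _ E Winv inv]
    unfolding E_def by (auto simp: fun_space.subspace_span)
  have "\<exists>c. pullback (S t) f = fscale (b t) f + fscale c g" if t: "t \<ge> 0" for t
  proof -
    obtain c where "pullback (S t) f - fscale (b t) f = fscale c g"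
      using fb[OF t] by (auto simp: fun_space.span_singleton)
    then show ?thesis by (metis add.commute diff_add_cancel)
  qed
  then obtain c where fc: "\<And>t. t \<ge> 0 \<Longrightarrow> pullback (S t) f = fscale (b t) f + fscale (c t) g"
    by metis
  have func: "functional f" "functional g"
    using f(1) g(1) generators_functional unfolding E_def by auto
  obtain x where x: "g x \<noteq> 0" using g(2) by (auto simp: fun_eq_iff)
  have "\<exists>y. g y = 0 \<and> f y \<noteq> 0"
  proof (rule ccontr)
    assume no: "\<not> ?thesis"
    have "f = fscale (f x / g x) g"
    proof
      fix y
      obtain k where k: "g y / g x = \<iota> k" using ratio[OF x] by auto
      have "\<iota> (- k) = - \<iota> k" using \<iota>_diff[of 0 k] by simp
      then have "g (y + fscale (- k) x) = 0" "f (y + fscale (- k) x) = f y - \<iota> k * f x"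
        unfolding functionalD(1,2)[OF func(1)] functionalD(1,2)[OF func(2)]
        using x by (simp_all add: k[symmetric])
      then have "f y = \<iota> k * f x" using no by auto
      then show "f y = fscale (f x / g x) g y" by (simp add: k[symmetric] fscale_def)
    qed
    moreover have "fscale (f x / g x) g \<in> ?W" by (intro fun_space.span_scale fun_space.span_base) simp
    ultimately show False using f(2) by simp
  qed
  then obtain y where "g y = 0" "f y \<noteq> 0" by blast
  from not_supercyclic[OF super func g(2) ga fc this] show False by simp
qed

end

section \<open>The complex and the real case\<close>

proposition complex_semigroup_not_supercyclic:
  fixes S :: "real \<Rightarrow> complex omega \<Rightarrow> complex omega"
  assumes "operator_semigroup S" "strongly_continuous S"
  shows "\<not> supercyclic S"
proof
  assume super: "supercyclic S"
  interpret strongly_continuous_semigroup "\<lambda>z :: complex. z" S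
    using assms by unfold_locales auto
  obtain \<tau> m where \<tau>: "\<tau> > 0" and E: "fun_space.span (generators 3 \<tau>) \<subseteq> fun_space.span (coord ` {..<m})"
    and "\<forall>t\<ge>0. \<forall>f\<in>fun_space.span (generators 3 \<tau>).
      pullback (S t) f \<in> fun_space.span (generators 3 \<tau>)"
    using ex_invariant_span[of 3] by (elim exE conjE)
  let ?E = "fun_space.span (generators 3 \<tau>)"
  have inv: "pullback (S t) f \<in> ?E" if "t \<ge> 0" "f \<in> ?E" for t f
    using \<open>\<forall>t\<ge>0. _ t\<close> that by simp
  have "coord 0 \<in> ?E" using coord_in_generators[of \<tau> 0 3] \<tau> by (auto intro: fun_space.span_base)
  then obtain g a where g: "g \<in> ?E" "g \<noteq> 0"
    and ga: "\<forall>t\<ge>0. pullback (S t) g = fscale (a t) g"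
    using ex_eigenfunctional[OF fun_space.subspace_span _ E inv _ coord_nonzero[of 0]] by auto
  show False
  proof (rule no_scalar_eigenfunctional[OF super \<tau> E inv g])
    show "pullback (S t) g = fscale (a t) g" if "t \<ge> 0" for t using ga that by blast
    show "g y / g x \<in> range (\<lambda>z. z)" for x y by (rule range_eqI[OF refl])
  qed
qed

text \<open>If all eigenvalues \<open>a t\<close> are real, the real or the imaginary part of
  \<open>g\<close> is a non-zero eigenfunctional with real values, and
  \<open>no_scalar_eigenfunctional\<close> applies. Otherwise \<open>g\<close> maps onto the complex
  plane, \<open>conj g\<close> is another eigenfunctional, and the partner of \<open>g\<close> is
  sought modulo both.\<close>

proposition real_semigroup_not_supercyclic:
  fixes S :: "real \<Rightarrow> real omega \<Rightarrow> real omega"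
  assumes "operator_semigroup S" "strongly_continuous S"
  shows "\<not> supercyclic S"
proof
  assume super: "supercyclic S"
  interpret strongly_continuous_semigroup complex_of_real S
    using assms by unfold_locales auto
  obtain \<tau> m where \<tau>: "\<tau> > 0" and E: "fun_space.span (generators 3 \<tau>) \<subseteq> fun_space.span (coord ` {..<m})"
    and "\<forall>t\<ge>0. \<forall>f\<in>fun_space.span (generators 3 \<tau>).
      pullback (S t) f \<in> fun_space.span (generators 3 \<tau>)"
    using ex_invariant_span[of 3] by (elim exE conjE)
  let ?E = "fun_space.span (generators 3 \<tau>)"
  have inv: "pullback (S t) f \<in> ?E" if "t \<ge> 0" "f \<in> ?E" for t f
    using \<open>\<forall>t\<ge>0. _ t\<close> that by simp
  have coordE: "coord ` {..<3} \<subseteq> ?E"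
    using coord_in_generators[of \<tau> _ 3] \<tau> by (auto intro!: fun_space.span_base)
  have "coord 0 \<in> ?E" using coordE by auto
  then obtain g a where g: "g \<in> ?E" "g \<noteq> 0"
    and "\<forall>t\<ge>0. pullback (S t) g = fscale (a t) g"
    using ex_eigenfunctional[OF fun_space.subspace_span _ E inv _ coord_nonzero[of 0]] by auto
  then have ga: "pullback (S t) g = fscale (a t) g" if "t \<ge> 0" for t using that by auto
  define conj :: "(real omega \<Rightarrow> complex) \<Rightarrow> (real omega \<Rightarrow> complex)"
    where "conj f = (\<lambda>x. cnj (f x))" for f
  have conj_simps: "conj 0 = 0" "conj (h + k) = conj h + conj k" "conj (h - k) = conj h - conj k"
      "conj (fscale c h) = fscale (cnj c) (conj h)" "pullback T (conj h) = conj (pullback T h)"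
      "conj (conj h) = h" for h k c T
    by (auto simp: conj_def fscale_def pullback_def fun_eq_iff)
  have conj_span: "conj f \<in> fun_space.span H"
    if H: "\<And>h. h \<in> G \<Longrightarrow> conj h \<in> fun_space.span H" and f: "f \<in> fun_space.span G" for f G H
    using f
  proof (induction rule: fun_space.span_induct_alt)
    case base
    show ?case unfolding conj_simps by (rule fun_space.span_zero)
  next
    case (step c x y)
    show ?case unfolding conj_simps
      by (intro fun_space.span_add fun_space.span_scale H[OF step(1)] step(2))
  qed
  have conjE: "conj f \<in> ?E" if "f \<in> ?E" for f
    using _ that
  proof (rule conj_span)
    fix h assume h: "h \<in> generators 3 \<tau>"
    then have "conj h = h" by (auto simp: generators_def pullback_def coord_def conj_def)
    then show "conj h \<in> ?E" using h by (simp add: fun_space.span_base)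
  qed
  have ga': "pullback (S t) (conj g) = fscale (cnj (a t)) (conj g)" if "t \<ge> 0" for t
    by (simp only: conj_simps ga[OF that])
  show False
  proof (cases "\<forall>t\<ge>0. cnj (a t) = a t")
    case True
    \<comment> \<open>The real and the imaginary part of \<open>g\<close>, obtained as complex
      combinations so that they visibly stay in \<open>?E\<close>.\<close>
    define p where "p = fscale (1 / 2) (g + conj g)"
    define q where "q = fscale (- \<i> / 2) (g - conj g)"
    have pq: "p x = complex_of_real (Re (g x))" "q x = complex_of_real (Im (g x))" for x
      by (simp_all add: p_def q_def fscale_def conj_def complex_eq_iff)
    have pqE: "p \<in> ?E" "q \<in> ?E"
      unfolding p_def q_def
      by (intro fun_space.span_scale fun_space.span_add fun_space.span_diff g conjE)+
    have eig: "pullback (S t) p = fscale (a t) p" "pullback (S t) q = fscale (a t) q" if "t \<ge> 0" for t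
    proof -
      have a: "cnj (a t) = a t" using True that by blast
      show "pullback (S t) p = fscale (a t) p" "pullback (S t) q = fscale (a t) q"
        unfolding p_def q_def pullback_simps ga[OF that] ga'[OF that] a
        by (auto simp: fscale_def fun_eq_iff algebra_simps)
    qed
    have quot: "complex_of_real y / complex_of_real x \<in> range complex_of_real" for x y
      by (metis of_real_divide rangeI)
    show False
    proof (cases "p = 0")
      case False
      show False
        by (rule no_scalar_eigenfunctional[OF super \<tau> E inv pqE(1) False eig(1)])
          (simp_all only: pq quot)
    next
      case True
      have "q \<noteq> 0"
      proof
        assume "q = 0"
        then have "g x = 0" for x
          using True pq[of x] by (simp add: complex_eq_iff)
        then show False using g(2) by (auto simp: fun_eq_iff)
      qed
      show False
        by (rule no_scalar_eigenfunctional[OF super \<tau> E inv pqE(2) \<open>q \<noteq> 0\<close> eig(2)])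
          (simp_all only: pq quot)
    qed
  next
    case False
    then obtain u where u: "u \<ge> 0" "cnj (a u) \<noteq> a u" by blast
    let ?W = "fun_space.span {g, conj g}"
    have gW: "g \<in> ?W" "conj g \<in> ?W" by (simp_all add: fun_space.span_base)
    have W: "?W \<subset> ?E"
    proof
      show "?W \<subseteq> ?E" using g(1) conjE
        by (intro fun_space.span_minimal fun_space.subspace_span) auto
      have "card {g, conj g} < card {..<3::nat}"
        using card_insert_le_m1[of 2 "{conj g}" g] by simp
      then have "\<not> coord ` {..<3} \<subseteq> ?W" by (intro coord_not_subset_span) auto
      then show "?W \<noteq> ?E" using coordE by metis
    qed
    have Winv: "pullback (S t) f \<in> ?W" if "t \<ge> 0" "f \<in> ?W" for t f
      using _ that(2)
    proof (rule pullback_span)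
      show "pullback (S t) h \<in> ?W" if "h \<in> {g, conj g}" for h
        using that gW ga[OF \<open>t \<ge> 0\<close>] ga'[OF \<open>t \<ge> 0\<close>] by (auto intro: fun_space.span_scale)
    qed
    have Wconj: "conj f \<in> ?W" if "f \<in> ?W" for f
      using _ that by (rule conj_span) (use gW in \<open>auto simp: conj_simps\<close>)
    have Wrep: "\<exists>c d. f = fscale c g + fscale d (conj g)" if "f \<in> ?W" for f
    proof -
      obtain c where "f - fscale c g \<in> fun_space.span {conj g}"
        using \<open>f \<in> ?W\<close> by (auto simp: fun_space.span_breakdown_eq)
      then obtain d where "f - fscale c g = fscale d (conj g)"
        by (auto simp: fun_space.span_singleton)
      then show ?thesis by (metis add.commute diff_add_cancel)
    qed
    obtain f0 b0 where f0: "f0 \<in> ?E" "f0 \<notin> ?W"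
      and fb0: "\<And>t. t \<ge> 0 \<Longrightarrow> pullback (S t) f0 - fscale (b0 t) f0 \<in> ?W"
      using ex_eigenfunctional_mod[OF fun_space.subspace_span W fun_space.subspace_span _ E Winv inv]
      by auto
    \<comment> \<open>If the eigenvalue of \<open>f0\<close> at time \<open>u\<close> is
      \<open>cnj (a u)\<close>, then that of \<open>conj f0\<close> is \<open>a u\<close>, which is
      different because \<open>a u\<close> is not real.\<close>
    have "\<exists>f b. f \<in> ?E \<and> f \<notin> ?W \<and> (\<forall>t\<ge>0. pullback (S t) f - fscale (b t) f \<in> ?W) \<and>
        b u \<noteq> cnj (a u)"
    proof (cases "b0 u = cnj (a u)")
      case False
      then show ?thesis using f0 fb0 by blast
    next
      case True
      have "pullback (S t) (conj f0) - fscale (cnj (b0 t)) (conj f0) \<in> ?W" if "t \<ge> 0" for t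
        using Wconj[OF fb0[OF that]] by (simp only: conj_simps)
      moreover have "conj f0 \<notin> ?W" using f0(2) Wconj[of "conj f0"] by (auto simp: conj_simps)
      moreover have "cnj (b0 u) \<noteq> cnj (a u)" using True u by auto
      ultimately show ?thesis using conjE[OF f0(1)] by (intro exI[of _ "conj f0"] exI[of _ "\<lambda>t. cnj (b0 t)"]) auto
    qed
    then obtain f b where f: "f \<in> ?E" "f \<notin> ?W" and bu: "b u \<noteq> cnj (a u)"
      and fb: "\<And>t. t \<ge> 0 \<Longrightarrow> pullback (S t) f - fscale (b t) f \<in> ?W" by blast
    have "\<exists>c d. pullback (S t) f = fscale (b t) f + fscale c g + fscale d (conj g)" if t: "t \<ge> 0" for t
      using Wrep[OF fb[OF t]] by (metis add.assoc add.commute diff_add_cancel)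
    then obtain c d where fcd:
      "\<And>t. t \<ge> 0 \<Longrightarrow> pullback (S t) f = fscale (b t) f + fscale (c t) g + fscale (d t) (conj g)"
      by metis
    \<comment> \<open>The operator \<open>pullback (S u) - cnj (a u)\<close> commutes with the
      semigroup and kills \<open>conj g\<close>, so the unwanted term in the expansion of
      \<open>f\<close> disappears. Modulo \<open>?W\<close> it multiplies \<open>f\<close> by
      \<open>b u - cnj (a u)\<close>, which is non-zero.\<close>
    define h where "h = pullback (S u) f - fscale (cnj (a u)) f"
    have hE: "h \<in> ?E" unfolding h_def using u f
      by (intro fun_space.span_diff fun_space.span_scale inv)
    have hW: "h \<notin> ?W"
    proof
      assume "h \<in> ?W"
      then have "h - (pullback (S u) f - fscale (b u) f) \<in> ?W"
        using fb[OF u(1)] by (rule fun_space.span_diff)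
      moreover have "h - (pullback (S u) f - fscale (b u) f) = fscale (b u - cnj (a u)) f"
        by (simp add: h_def fun_space.scale_left_diff_distrib)
      ultimately have "fscale (inverse (b u - cnj (a u))) (fscale (b u - cnj (a u)) f) \<in> ?W"
        by (simp only:) (rule fun_space.span_scale)
      then show False using f(2) bu by (simp add: fun_space.scale_scale)
    qed
    have hb: "pullback (S t) h = fscale (b t) h + fscale (c t * (a u - cnj (a u))) g"
      if t: "t \<ge> 0" for t
    proof
      fix x
      note ev = fun_cong[OF fcd[OF t]] and ev' = fun_cong[OF ga[OF u(1)]]
      have "f (S u (S t x)) = f (S t (S u x))" using t u(1) by (simp add: S_commute)
      also have "\<dots> = b t * f (S u x) + c t * (a u * g x) + d t * cnj (a u * g x)"
        using ev[of "S u x"] ev'[of x] by (simp add: pullback_def fscale_def conj_def)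
      finally show "pullback (S t) h x = (fscale (b t) h + fscale (c t * (a u - cnj (a u))) g) x"
        using ev[of x] by (simp add: h_def pullback_def fscale_def conj_def algebra_simps)
    qed
    have func: "functional h" "functional g" using hE g(1) generators_functional by auto
    note h' = functionalD[OF func(1)] and g' = functionalD[OF func(2)]
    \<comment> \<open>The values of \<open>g\<close> at \<open>z\<close> and \<open>S u z\<close>
      are \<open>g z\<close> and \<open>a u * g z\<close>; as \<open>a u\<close> is not real, they
      form a real basis of the complex plane.\<close>
    have onto: "\<exists>x. g x = w" for w
    proof -
      obtain z where z: "g z \<noteq> 0" using g(2) by (auto simp: fun_eq_iff)
      have im: "Im (a u) \<noteq> 0" using u(2) by (auto simp: complex_eq_iff)
      define k where "k = w / g z"
      define l where "l = Im k / Im (a u)"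
      let ?x = "fscale (Re k - l * Re (a u)) z + fscale l (S u z)"
      have "g (S u z) = a u * g z"
        using fun_cong[OF ga[OF u(1)], of z] by (simp add: pullback_def fscale_def)
      then have "g ?x = (complex_of_real (Re k - l * Re (a u)) + complex_of_real l * a u) * g z"
        by (simp only: g' distrib_right mult.assoc)
      also have "complex_of_real (Re k - l * Re (a u)) + complex_of_real l * a u = k"
        using im by (simp add: complex_eq_iff l_def)
      also have "k * g z = w" using z by (simp add: k_def)
      finally show ?thesis by blast
    qed
    obtain x1 x2 where x12: "g x1 = 1" "g x2 = \<i>" using onto by metis
    have "\<exists>y. g y = 0 \<and> h y \<noteq> 0"
    proof (rule ccontr)
      assume no: "\<not> ?thesis"
      \<comment> \<open>If \<open>h\<close> vanishes on the kernel of \<open>g\<close>, then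
        \<open>h y\<close> is the real-linear function
        \<open>Re (g y) * h x1 + Im (g y) * h x2\<close> of \<open>g y\<close>; expressing
        \<open>Re\<close> and \<open>Im\<close> through \<open>g y\<close> and its conjugate gives
        the coefficients.\<close>
      have "h = fscale ((h x1 - \<i> * h x2) / 2) g + fscale ((h x1 + \<i> * h x2) / 2) (conj g)"
      proof
        fix y
        let ?z = "y + (fscale (- Re (g y)) x1 + fscale (- Im (g y)) x2)"
        have "g ?z = 0" unfolding g'(1,2) by (simp add: x12 complex_eq_iff)
        then have "h ?z = 0" using no by blast
        then have "h y = Re (g y) * h x1 + Im (g y) * h x2"
          unfolding h'(1,2) by (simp add: algebra_simps add_eq_0_iff)
        then show "h y = (fscale ((h x1 - \<i> * h x2) / 2) g + fscale ((h x1 + \<i> * h x2) / 2) (conj g)) y"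
          by (simp add: fscale_def conj_def complex_eq_iff field_simps)
      qed
      moreover have "fscale ((h x1 - \<i> * h x2) / 2) g + fscale ((h x1 + \<i> * h x2) / 2) (conj g) \<in> ?W"
        by (intro fun_space.span_add fun_space.span_scale fun_space.span_base) auto
      ultimately show False using hW by metis
    qed
    then obtain y where "g y = 0" "h y \<noteq> 0" by blast
    from not_supercyclic[OF super func g(2) ga hb this] show False by simp
  qed
qed

theorem theorem1p7:
  shows "(\<forall>(T :: real omega \<Rightarrow> real omega) (p :: nat \<Rightarrow> real poly).
            T \<in> operators \<longrightarrow>
            (\<nexists>M. dual_invariant_subspace T M \<and> finite_dim M \<and> M \<noteq> {0}) \<longrightarrow>
            filterlim (\<lambda>l. degree (p l)) at_top sequentially \<longrightarrow>
            universal (\<lambda>l. poly_op (p l) T)) \<and>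
         (\<nexists>S :: real \<Rightarrow> real omega \<Rightarrow> real omega.
            operator_semigroup S \<and> strongly_continuous S \<and> supercyclic S) \<and>
         (\<forall>(T :: complex omega \<Rightarrow> complex omega) (p :: nat \<Rightarrow> complex poly).
            T \<in> operators \<longrightarrow>
            (\<nexists>M. dual_invariant_subspace T M \<and> finite_dim M \<and> M \<noteq> {0}) \<longrightarrow>
            filterlim (\<lambda>l. degree (p l)) at_top sequentially \<longrightarrow>
            universal (\<lambda>l. poly_op (p l) T)) \<and>
         (\<nexists>S :: real \<Rightarrow> complex omega \<Rightarrow> complex omega.
            operator_semigroup S \<and> strongly_continuous S \<and> supercyclic S)"
proof (intro conjI allI impI)
qed (use universal_poly_op real_semigroup_not_supercyclic complex_semigroup_not_supercyclic in blast)+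

end
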